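(* Let $M$ be a monoid with monoid presentation $\langle X_M : R_M\rangle$ via a surjective morphism $\phi_M:X_M^*\to M$, and write $\overline x=x\phi_M$ for $x\in X_M$. Let $\Delta$ be the digraph with vertex set $\mathbb N=\{0,1,2,\ldots\}$ and (pairwise distinct) edges $X:2\to2$, $U:1\to0$, $V:0\to1$, and $x:1\to1$ for each $x\in X_M$. Write $\iota_n$ for the identity at $n$ in the free tensor category $\Delta^{\circledast}$ and $I=\iota_1$. Let $\Xi$ be the set of relations over $\Delta^{\circledast}$ consisting of the relations in $R_M$ (where a word $x_1\cdots x_k\in X_M^*$ is identified with the term $x_1\circ\cdots\circ x_k:1\to1$, and the empty word with $I$) together with the following, where $x$ ranges over $X_M$: (1) $X\circ X=\iota_2$; $(X\oplus I)\circ(I\oplus X)\circ(X\oplus I)=(I\oplus X)\circ(X\oplus I)\circ(I\oplus X)$; (2) $V\circ U=\iota_0$; $X\circ(U\oplus I)=I\oplus U$; $(V\oplus I)\circ X=I\oplus V$; (3) $X\circ(x\oplus I)=(I\oplus x)\circ X$; $x\circ U=U$; $V\circ x=V$. Let $\Phi:\Delta^{\circledast}\to M\wr\mathcal I$ be the tensor category morphism (identity on objects) determined by - $X\mapsto((1,1),(1,2))$, where $(1,2)$ is the transposition swapping $1$ and $2$; - $U\mapsto$ the unique morphism $1\to0$ of $M\wr\mathcal I$ (namely the tuple $(0)$ with the empty map); - $V\mapsto$ the unique morphism $0\to1$ of $M\wr\mathcal I$ (namely the empty tuple with the empty map); - $x\mapsto((\overline x),\mathrm{id}_{\{1\}})$,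 an endomorphism of $1$, for $x\in X_M$. Then the category $M\wr\mathcal I$ has tensor category presentation $\langle\Delta:\Xi\rangle$ via $\Phi$.
   Context: All categories here are small with object set $\mathbb N=\{0,1,2,\ldots\}$, identified with their morphism sets; $\mathbf d(a),\mathbf r(a)$ denote the domain and range (codomain) of a morphism $a$, and morphisms are composed left to right ($a\circ b$ is defined iff $\mathbf r(a)=\mathbf d(b)$). Write $\mathbf n=\{1,\ldots,n\}$ ($\mathbf 0=\varnothing$). A (strict) tensor category is such a category $\mathcal C$, with identities $\iota_n$, with a total operation $\oplus:\mathcal C\times\mathcal C\to\mathcal C$ such that: $(\mathcal C,\oplus)$ is a monoid with identity $\iota_0$; $\mathbf d(a\oplus b)=\mathbf d(a)+\mathbf d(b)$ and $\mathbf r(a\oplus b)=\mathbf r(a)+\mathbf r(b)$; $\iota_m\oplus\iota_n=\iota_{m+n}$; and $(a\circ b)\oplus(c\circ d)=(a\oplus c)\circ(b\oplus d)$ whenever $\mathbf r(a)=\mathbf d(b)$ and $\mathbf r(c)=\mathbf d(d)$. A tensor category morphism is a functor that is the identity on objects and preserves $\oplus$. For a digraph $\Delta$ on vertex set $\mathbb N$, $\Delta^{\circledast}$ is the free (strict) tensor category over $\Delta$: it consists of all formal terms built from the identities $\iota_n$ ($n\in\mathbb N$) and the edges of $\Delta$ (with their sources and targets as domains and ranges) using $\circ$ (when $\mathbf r(s)=\mathbf d(t)$) and $\oplus$, taken modulo the axioms of strict tensor categories. A tensor congruence is an equivalence relation on morphisms, relating only morphisms with equal domains and equal ranges, compatible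 on both sides with $\circ$ and with $\oplus$. For a set $\Xi$ of pairs of terms $(u,v)$ with $\mathbf d(u)=\mathbf d(v)$, $\mathbf r(u)=\mathbf r(v)$ (written $u=v$), let $\Xi^\sharp_\oplus$ be the tensor congruence on $\Delta^{\circledast}$ generated by $\Xi$. A tensor category $\mathcal C$ has tensor category presentation $\langle\Delta:\Xi\rangle$ via $\Phi$ if $\Phi:\Delta^{\circledast}\to\mathcal C$ is a tensor category morphism that is surjective on morphisms and has kernel $\{(u,v):u\Phi=v\Phi\}$ equal to $\Xi^\sharp_\oplus$. A monoid $N$ has monoid presentation $\langle Y:R\rangle$ via $\phi$ if $\phi:Y^*\to N$ is a surjective monoid morphism from the free monoid $Y^*$ whose kernel is the congruence generated by $R$. The symmetric inverse category $\mathcal I$ has as morphisms $m\to n$ the set $\mathcal I_{m,n}$ of all injective partial maps $\mathbf m\to\mathbf n$ (the pair $(m,n)$ being regarded as part of the data), composed left to right. For $\alpha\in\mathcal I_{m,n}$ and $\beta\in\mathcal I_{k,l}$, $\alpha\oplus\beta\in\mathcal I_{m+k,n+l}$ is given by $x(\alpha\oplus\beta)=x\alpha$ if $1\le x\le m$ and $x\in\mathrm{dom}(\alpha)$, $x(\alpha\oplus\beta)=(x-m)\beta+n$ if $m+1\le x\le m+k$ and $x-m\in\mathrm{dom}(\beta)$, and undefined otherwise. $M_0=M\cup\{0\}$ is obtained from $M$ (with identity $1$) by adjoining a new symbol $0$ as a zero element (even if $M$ already has a zero). For $\mathbf a\in M_0^n$, $\mathrm{supp}(\mathbf a)=\{i\in\mathbf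 n:a_i\ne0\}$. For $\alpha\in\mathcal I_{m,n}$ and $\mathbf a\in M_0^n$, ${}^\alpha\mathbf a=(b_1,\ldots,b_m)\in M_0^m$ where $b_i=a_{i\alpha}$ if $i\in\mathrm{dom}(\alpha)$ and $b_i=0$ otherwise. For tuples, $\oplus$ is concatenation. The wreath product $M\wr\mathcal I$ is the tensor category whose morphisms $m\to n$ are the pairs $(\mathbf a,\alpha)\in M_0^m\times\mathcal I_{m,n}$ with $\mathrm{supp}(\mathbf a)=\mathrm{dom}(\alpha)$, with $(\mathbf a,\alpha)\circ(\mathbf b,\beta)=(\mathbf a\cdot{}^\alpha\mathbf b,\alpha\beta)$ (for composable $\alpha,\beta$; the product of tuples is componentwise) and $(\mathbf a,\alpha)\oplus(\mathbf b,\beta)=(\mathbf a\oplus\mathbf b,\alpha\oplus\beta)$. *)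

theory Defs
  imports "HOL-Algebra.Group" "Graph_Theory.Digraph"
begin

section \<open>Strict tensor categories with object set \<open>\<nat>\<close>\<close>

text \<open>
  A category is identified with its set of morphisms. Composition is written from left to right,
  so \<open>a \<odot> b\<close> is meaningful only if \<open>rng a = src b\<close>; its value on other pairs is irrelevant.
\<close>

record 'a tensor_cat =
  mors :: "'a set"
  src :: "'a \<Rightarrow> nat"
  rng :: "'a \<Rightarrow> nat"
  ident :: "nat \<Rightarrow> 'a"
  tcomp :: "'a \<Rightarrow> 'a \<Rightarrow> 'a" (infixl "\<odot>\<index>" 70)
  tens :: "'a \<Rightarrow> 'a \<Rightarrow> 'a" (infixl "\<oplus>\<index>" 65)

locale tensor_category =
  fixes C :: "'a tensor_cat" (structure)
  assumes ident_closed: "ident C n \<in> mors C"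
    and src_ident: "src C (ident C n) = n"
    and rng_ident: "rng C (ident C n) = n"
    and comp_closed: "\<lbrakk>a \<in> mors C; b \<in> mors C; rng C a = src C b\<rbrakk> \<Longrightarrow> a \<odot> b \<in> mors C"
    and src_comp: "\<lbrakk>a \<in> mors C; b \<in> mors C; rng C a = src C b\<rbrakk> \<Longrightarrow> src C (a \<odot> b) = src C a"
    and rng_comp: "\<lbrakk>a \<in> mors C; b \<in> mors C; rng C a = src C b\<rbrakk> \<Longrightarrow> rng C (a \<odot> b) = rng C b"
    and comp_assoc: "\<lbrakk>a \<in> mors C; b \<in> mors C; c \<in> mors C; rng C a = src C b; rng C b = src C c\<rbrakk>
        \<Longrightarrow> (a \<odot> b) \<odot> c = a \<odot> (b \<odot> c)"
    and ident_comp: "a \<in> mors C \<Longrightarrow> ident C (src C a) \<odot> a = a"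
    and comp_ident: "a \<in> mors C \<Longrightarrow> a \<odot> ident C (rng C a) = a"
    and tens_closed: "\<lbrakk>a \<in> mors C; b \<in> mors C\<rbrakk> \<Longrightarrow> a \<oplus> b \<in> mors C"
    and src_tens: "\<lbrakk>a \<in> mors C; b \<in> mors C\<rbrakk> \<Longrightarrow> src C (a \<oplus> b) = src C a + src C b"
    and rng_tens: "\<lbrakk>a \<in> mors C; b \<in> mors C\<rbrakk> \<Longrightarrow> rng C (a \<oplus> b) = rng C a + rng C b"
    and tens_assoc: "\<lbrakk>a \<in> mors C; b \<in> mors C; c \<in> mors C\<rbrakk> \<Longrightarrow> (a \<oplus> b) \<oplus> c = a \<oplus> (b \<oplus> c)"
    and unit_tens: "a \<in> mors C \<Longrightarrow> ident C 0 \<oplus> a = a"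
    and tens_unit: "a \<in> mors C \<Longrightarrow> a \<oplus> ident C 0 = a"
    and ident_tens: "ident C m \<oplus> ident C n = ident C (m + n)"
    and interchange: "\<lbrakk>a \<in> mors C; b \<in> mors C; c \<in> mors C; d \<in> mors C;
        rng C a = src C b; rng C c = src C d\<rbrakk>
        \<Longrightarrow> (a \<odot> b) \<oplus> (c \<odot> d) = (a \<oplus> c) \<odot> (b \<oplus> d)"

text \<open>
  Tensor category morphisms are extensional functions on the set of morphisms, so that equality
  of HOL functions is equality of tensor category morphisms.
\<close>

definition tensor_morphism :: "'a tensor_cat \<Rightarrow> 'b tensor_cat \<Rightarrow> ('a \<Rightarrow> 'b) \<Rightarrow> bool" where
  "tensor_morphism C D \<Phi> \<longleftrightarrow>
     \<Phi> \<in> mors C \<rightarrow>\<^sub>E mors D \<and>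
     (\<forall>a\<in>mors C. src D (\<Phi> a) = src C a \<and> rng D (\<Phi> a) = rng C a) \<and>
     (\<forall>n. \<Phi> (ident C n) = ident D n) \<and>
     (\<forall>a\<in>mors C. \<forall>b\<in>mors C. rng C a = src C b \<longrightarrow> \<Phi> (a \<odot>\<^bsub>C\<^esub> b) = \<Phi> a \<odot>\<^bsub>D\<^esub> \<Phi> b) \<and>
     (\<forall>a\<in>mors C. \<forall>b\<in>mors C. \<Phi> (a \<oplus>\<^bsub>C\<^esub> b) = \<Phi> a \<oplus>\<^bsub>D\<^esub> \<Phi> b)"

definition parallel_pairs :: "'a tensor_cat \<Rightarrow> ('a \<times> 'a) set" where
  "parallel_pairs C =
     {(a, b). a \<in> mors C \<and> b \<in> mors C \<and> src C a = src C b \<and> rng C a = rng C b}"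

definition tensor_congruence :: "'a tensor_cat \<Rightarrow> ('a \<times> 'a) set \<Rightarrow> bool" where
  "tensor_congruence C r \<longleftrightarrow>
     equiv (mors C) r \<and> r \<subseteq> parallel_pairs C \<and>
     (\<forall>(a, b)\<in>r. \<forall>c\<in>mors C.
        (rng C c = src C a \<longrightarrow> (c \<odot>\<^bsub>C\<^esub> a, c \<odot>\<^bsub>C\<^esub> b) \<in> r) \<and>
        (rng C a = src C c \<longrightarrow> (a \<odot>\<^bsub>C\<^esub> c, b \<odot>\<^bsub>C\<^esub> c) \<in> r) \<and>
        (c \<oplus>\<^bsub>C\<^esub> a, c \<oplus>\<^bsub>C\<^esub> b) \<in> r \<and> (a \<oplus>\<^bsub>C\<^esub> c, b \<oplus>\<^bsub>C\<^esub> c) \<in> r)"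

text \<open>Only meaningful for \<open>\<Xi> \<subseteq> parallel_pairs C\<close>; otherwise the intersection may be over the empty family.\<close>

definition generated_tensor_congruence :: "'a tensor_cat \<Rightarrow> ('a \<times> 'a) set \<Rightarrow> ('a \<times> 'a) set" where
  "generated_tensor_congruence C \<Xi> = \<Inter>{r. tensor_congruence C r \<and> \<Xi> \<subseteq> r}"


section \<open>The free tensor category over a digraph\<close>

datatype 'e trm = Ident nat | Edge 'e | Comp "'e trm" "'e trm" | Tens "'e trm" "'e trm"

primrec trm_src :: "(nat, 'e) pre_digraph \<Rightarrow> 'e trm \<Rightarrow> nat" where
  "trm_src G (Ident n) = n"
| "trm_src G (Edge e) = tail G e"
| "trm_src G (Comp s t) = trm_src G s"
| "trm_src G (Tens s t) = trm_src G s + trm_src G t"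

primrec trm_rng :: "(nat, 'e) pre_digraph \<Rightarrow> 'e trm \<Rightarrow> nat" where
  "trm_rng G (Ident n) = n"
| "trm_rng G (Edge e) = head G e"
| "trm_rng G (Comp s t) = trm_rng G t"
| "trm_rng G (Tens s t) = trm_rng G s + trm_rng G t"

primrec wf_trm :: "(nat, 'e) pre_digraph \<Rightarrow> 'e trm \<Rightarrow> bool" where
  "wf_trm G (Ident n) \<longleftrightarrow> True"
| "wf_trm G (Edge e) \<longleftrightarrow> e \<in> arcs G"
| "wf_trm G (Comp s t) \<longleftrightarrow> wf_trm G s \<and> wf_trm G t \<and> trm_rng G s = trm_src G t"
| "wf_trm G (Tens s t) \<longleftrightarrow> wf_trm G s \<and> wf_trm G t"

inductive trm_eq :: "(nat, 'e) pre_digraph \<Rightarrow> 'e trm \<Rightarrow> 'e trm \<Rightarrow> bool" for G where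
  refl: "wf_trm G t \<Longrightarrow> trm_eq G t t"
| sym: "trm_eq G s t \<Longrightarrow> trm_eq G t s"
| trans: "\<lbrakk>trm_eq G s t; trm_eq G t u\<rbrakk> \<Longrightarrow> trm_eq G s u"
| cong_Comp: "\<lbrakk>trm_eq G s s'; trm_eq G t t'; trm_rng G s = trm_src G t\<rbrakk>
    \<Longrightarrow> trm_eq G (Comp s t) (Comp s' t')"
| cong_Tens: "\<lbrakk>trm_eq G s s'; trm_eq G t t'\<rbrakk> \<Longrightarrow> trm_eq G (Tens s t) (Tens s' t')"
| Comp_assoc: "wf_trm G (Comp (Comp s t) u)
    \<Longrightarrow> trm_eq G (Comp (Comp s t) u) (Comp s (Comp t u))"
| Ident_Comp: "wf_trm G t \<Longrightarrow> trm_eq G (Comp (Ident (trm_src G t)) t) t"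
| Comp_Ident: "wf_trm G t \<Longrightarrow> trm_eq G (Comp t (Ident (trm_rng G t))) t"
| Tens_assoc: "wf_trm G (Tens (Tens s t) u)
    \<Longrightarrow> trm_eq G (Tens (Tens s t) u) (Tens s (Tens t u))"
| Unit_Tens: "wf_trm G t \<Longrightarrow> trm_eq G (Tens (Ident 0) t) t"
| Tens_Unit: "wf_trm G t \<Longrightarrow> trm_eq G (Tens t (Ident 0)) t"
| Ident_Tens: "trm_eq G (Tens (Ident m) (Ident n)) (Ident (m + n))"
| Interchange: "wf_trm G (Tens (Comp s t) (Comp u v))
    \<Longrightarrow> trm_eq G (Tens (Comp s t) (Comp u v)) (Comp (Tens s u) (Tens t v))"

definition trm_rel :: "(nat, 'e) pre_digraph \<Rightarrow> ('e trm \<times> 'e trm) set" where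
  "trm_rel G = {(s, t). trm_eq G s t}"

definition trm_class :: "(nat, 'e) pre_digraph \<Rightarrow> 'e trm \<Rightarrow> 'e trm set" where
  "trm_class G t = trm_rel G `` {t}"

text \<open>
  The operations on classes do not depend on the representatives, so each \<open>the_elem\<close> is
  applied to a singleton and each union is over a single class.
\<close>

definition free_tensor_category :: "(nat, 'e) pre_digraph \<Rightarrow> 'e trm set tensor_cat" where
  "free_tensor_category G =
     \<lparr>mors = {t. wf_trm G t} // trm_rel G,
      src = (\<lambda>A. the_elem (trm_src G ` A)),
      rng = (\<lambda>A. the_elem (trm_rng G ` A)),
      ident = (\<lambda>n. trm_class G (Ident n)),
      tcomp = (\<lambda>A B. \<Union>s\<in>A. \<Union>t\<in>B. trm_class G (Comp s t)),
      tens = (\<lambda>A B. \<Union>s\<in>A. \<Union>t\<in>B. trm_class G (Tens s t))\<rparr>"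


section \<open>Presentations\<close>

definition tensor_presentation ::
  "'a tensor_cat \<Rightarrow> (nat, 'e) pre_digraph \<Rightarrow> ('e trm set \<times> 'e trm set) set
     \<Rightarrow> ('e trm set \<Rightarrow> 'a) \<Rightarrow> bool" where
  "tensor_presentation C G \<Xi> \<Phi> \<longleftrightarrow>
     tensor_category C \<and> wf_digraph G \<and> verts G = UNIV \<and>
     \<Xi> \<subseteq> parallel_pairs (free_tensor_category G) \<and>
     tensor_morphism (free_tensor_category G) C \<Phi> \<and>
     \<Phi> ` mors (free_tensor_category G) = mors C \<and>
     {(u, v). u \<in> mors (free_tensor_category G) \<and> v \<in> mors (free_tensor_category G) \<and> \<Phi> u = \<Phi> v}
       = generated_tensor_congruence (free_tensor_category G) \<Xi>"

definition free_monoid :: "'x set \<Rightarrow> 'x list monoid" where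
  "free_monoid X = \<lparr>carrier = lists X, mult = (@), one = []\<rparr>"

definition monoid_congruence :: "('a, 's) monoid_scheme \<Rightarrow> ('a \<times> 'a) set \<Rightarrow> bool" where
  "monoid_congruence N r \<longleftrightarrow>
     equiv (carrier N) r \<and>
     (\<forall>(a, b)\<in>r. \<forall>c\<in>carrier N. (c \<otimes>\<^bsub>N\<^esub> a, c \<otimes>\<^bsub>N\<^esub> b) \<in> r \<and> (a \<otimes>\<^bsub>N\<^esub> c, b \<otimes>\<^bsub>N\<^esub> c) \<in> r)"

definition generated_monoid_congruence ::
  "('a, 's) monoid_scheme \<Rightarrow> ('a \<times> 'a) set \<Rightarrow> ('a \<times> 'a) set" where
  "generated_monoid_congruence N R = \<Inter>{r. monoid_congruence N r \<and> R \<subseteq> r}"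

definition monoid_presentation ::
  "('m, 's) monoid_scheme \<Rightarrow> 'x set \<Rightarrow> ('x list \<times> 'x list) set \<Rightarrow> ('x list \<Rightarrow> 'm) \<Rightarrow> bool" where
  "monoid_presentation N Y R \<phi> \<longleftrightarrow>
     R \<subseteq> lists Y \<times> lists Y \<and>
     \<phi> \<in> hom (free_monoid Y) N \<and> \<phi> [] = \<one>\<^bsub>N\<^esub> \<and>
     \<phi> ` lists Y = carrier N \<and>
     {(u, v). u \<in> lists Y \<and> v \<in> lists Y \<and> \<phi> u = \<phi> v}
       = generated_monoid_congruence (free_monoid Y) R"


section \<open>The symmetric inverse category\<close>

text \<open>
  A morphism \<open>m \<rightarrow> n\<close> is a triple \<open>(m, n, \<alpha>)\<close>, where \<open>\<alpha>\<close> is an injective partial map from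
  \<open>{1..m}\<close> to \<open>{1..n}\<close>. Since \<^term>\<open>map_comp\<close> composes from right to left, the left-to-right
  composite of \<open>\<alpha>\<close> and \<open>\<beta>\<close> is \<open>\<beta> \<circ>\<^sub>m \<alpha>\<close>.
\<close>

type_synonym pmor = "nat \<times> nat \<times> (nat \<rightharpoonup> nat)"

definition partial_injections :: "nat \<Rightarrow> nat \<Rightarrow> (nat \<rightharpoonup> nat) set" where
  "partial_injections m n = {\<alpha>. dom \<alpha> \<subseteq> {1..m} \<and> ran \<alpha> \<subseteq> {1..n} \<and> inj_on \<alpha> (dom \<alpha>)}"

definition pmap_sum ::
  "nat \<Rightarrow> nat \<Rightarrow> nat \<Rightarrow> (nat \<rightharpoonup> nat) \<Rightarrow> (nat \<rightharpoonup> nat) \<Rightarrow> (nat \<rightharpoonup> nat)" where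
  "pmap_sum m n k \<alpha> \<beta> = (\<lambda>x.
     if x \<in> {1..m} then \<alpha> x
     else if x \<in> {m + 1..m + k} then map_option (\<lambda>y. y + n) (\<beta> (x - m))
     else None)"

definition sym_inv_category :: "pmor tensor_cat" where
  "sym_inv_category =
     \<lparr>mors = {(m, n, \<alpha>). \<alpha> \<in> partial_injections m n},
      src = (\<lambda>(m, n, \<alpha>). m),
      rng = (\<lambda>(m, n, \<alpha>). n),
      ident = (\<lambda>n. (n, n, Some |` {1..n})),
      tcomp = (\<lambda>(m, n, \<alpha>) (n', k, \<beta>). (m, k, \<beta> \<circ>\<^sub>m \<alpha>)),
      tens = (\<lambda>(m, n, \<alpha>) (k, l, \<beta>). (m + k, n + l, pmap_sum m n k \<alpha> \<beta>))\<rparr>"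


section \<open>The wreath product of a monoid with the symmetric inverse category\<close>

text \<open>
  The new zero is \<^const>\<open>None\<close>. Tuples are lists, so the \<open>i\<close>-th coordinate (\<open>1 \<le> i\<close>) of \<open>a\<close>
  is \<open>a ! (i - 1)\<close>.
\<close>

definition adjoin_zero :: "('m, 's) monoid_scheme \<Rightarrow> 'm option monoid" where
  "adjoin_zero M =
     \<lparr>carrier = insert None (Some ` carrier M),
      mult = (\<lambda>a b. case (a, b) of (Some x, Some y) \<Rightarrow> Some (x \<otimes>\<^bsub>M\<^esub> y) | _ \<Rightarrow> None),
      one = Some \<one>\<^bsub>M\<^esub>\<rparr>"

definition tuple_supp :: "'m option list \<Rightarrow> nat set" where
  "tuple_supp a = {i \<in> {1..length a}. a ! (i - 1) \<noteq> None}"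

text \<open>\<open>tuple_pull (m, n, \<alpha>) a\<close> is the tuple \<open>\<^sup>\<alpha>a\<close> of length \<open>m\<close>.\<close>

definition tuple_pull :: "pmor \<Rightarrow> 'm option list \<Rightarrow> 'm option list" where
  "tuple_pull = (\<lambda>(m, n, \<alpha>) a.
     map (\<lambda>i. case \<alpha> i of Some j \<Rightarrow> a ! (j - 1) | None \<Rightarrow> None) [1..<m + 1])"

type_synonym 'm wmor = "'m option list \<times> pmor"

definition wreath_category :: "('m, 's) monoid_scheme \<Rightarrow> 'm wmor tensor_cat" where
  "wreath_category M =
     \<lparr>mors = {(a, (m, n, \<alpha>)).
        (m, n, \<alpha>) \<in> mors sym_inv_category \<and>
        length a = m \<and> set a \<subseteq> carrier (adjoin_zero M) \<and> tuple_supp a = dom \<alpha>},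
      src = (\<lambda>(a, f). src sym_inv_category f),
      rng = (\<lambda>(a, f). rng sym_inv_category f),
      ident = (\<lambda>n. (replicate n (Some \<one>\<^bsub>M\<^esub>), ident sym_inv_category n)),
      tcomp = (\<lambda>(a, f) (b, g).
        (map2 (mult (adjoin_zero M)) a (tuple_pull f b), f \<odot>\<^bsub>sym_inv_category\<^esub> g)),
      tens = (\<lambda>(a, f) (b, g). (a @ b, f \<oplus>\<^bsub>sym_inv_category\<^esub> g))\<rparr>"


section \<open>Generators and relations for the wreath product\<close>

datatype 'x edge = EdgeX | EdgeU | EdgeV | Letter 'x

definition wreath_digraph :: "'x set \<Rightarrow> (nat, 'x edge) pre_digraph" where
  "wreath_digraph X =
     \<lparr>verts = UNIV,
      arcs = {EdgeX, EdgeU, EdgeV} \<union> Letter ` X,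
      tail = (\<lambda>e. case e of EdgeX \<Rightarrow> 2 | EdgeU \<Rightarrow> 1 | EdgeV \<Rightarrow> 0 | Letter x \<Rightarrow> 1),
      head = (\<lambda>e. case e of EdgeX \<Rightarrow> 2 | EdgeU \<Rightarrow> 0 | EdgeV \<Rightarrow> 1 | Letter x \<Rightarrow> 1)\<rparr>"

abbreviation wreath_free :: "'x set \<Rightarrow> 'x edge trm set tensor_cat" where
  "wreath_free X \<equiv> free_tensor_category (wreath_digraph X)"

definition gen :: "'x set \<Rightarrow> 'x edge \<Rightarrow> 'x edge trm set" where
  "gen X e = trm_class (wreath_digraph X) (Edge e)"

text \<open>
  The trailing identity in the fold is absorbed in the free tensor category, so
  \<open>[x\<^sub>1, \<dots>, x\<^sub>k]\<close> is sent to \<open>x\<^sub>1 \<odot> \<dots> \<odot> x\<^sub>k\<close>, and \<open>[]\<close> to the identity at 1.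
\<close>

definition word_mor :: "'x set \<Rightarrow> 'x list \<Rightarrow> 'x edge trm set" where
  "word_mor X w =
     foldr (\<lambda>x u. gen X (Letter x) \<odot>\<^bsub>wreath_free X\<^esub> u) w (ident (wreath_free X) 1)"

definition wreath_relations ::
  "'x set \<Rightarrow> ('x list \<times> 'x list) set \<Rightarrow> ('x edge trm set \<times> 'x edge trm set) set" where
  "wreath_relations X R =
    (let F = wreath_free X; I = ident F 1;
         T = gen X EdgeX; U = gen X EdgeU; V = gen X EdgeV; L = (\<lambda>x. gen X (Letter x))
     in {(word_mor X u, word_mor X v) | u v. (u, v) \<in> R} \<union>
        {(T \<odot>\<^bsub>F\<^esub> T, ident F 2),
         ((T \<oplus>\<^bsub>F\<^esub> I) \<odot>\<^bsub>F\<^esub> (I \<oplus>\<^bsub>F\<^esub> T) \<odot>\<^bsub>F\<^esub> (T \<oplus>\<^bsub>F\<^esub> I),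
          (I \<oplus>\<^bsub>F\<^esub> T) \<odot>\<^bsub>F\<^esub> (T \<oplus>\<^bsub>F\<^esub> I) \<odot>\<^bsub>F\<^esub> (I \<oplus>\<^bsub>F\<^esub> T))} \<union>
        {(V \<odot>\<^bsub>F\<^esub> U, ident F 0),
         (T \<odot>\<^bsub>F\<^esub> (U \<oplus>\<^bsub>F\<^esub> I), I \<oplus>\<^bsub>F\<^esub> U),
         ((V \<oplus>\<^bsub>F\<^esub> I) \<odot>\<^bsub>F\<^esub> T, I \<oplus>\<^bsub>F\<^esub> V)} \<union>
        (\<Union>x\<in>X. {(T \<odot>\<^bsub>F\<^esub> (L x \<oplus>\<^bsub>F\<^esub> I), (I \<oplus>\<^bsub>F\<^esub> L x) \<odot>\<^bsub>F\<^esub> T),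
                 (L x \<odot>\<^bsub>F\<^esub> U, U),
                 (V \<odot>\<^bsub>F\<^esub> L x, V)}))"

definition wreath_generator_map ::
  "('m, 's) monoid_scheme \<Rightarrow> 'x set \<Rightarrow> ('x list \<Rightarrow> 'm) \<Rightarrow> ('x edge trm set \<Rightarrow> 'm wmor) \<Rightarrow> bool" where
  "wreath_generator_map M X \<phi> \<Phi> \<longleftrightarrow>
     tensor_morphism (wreath_free X) (wreath_category M) \<Phi> \<and>
     \<Phi> (gen X EdgeX) = ([Some \<one>\<^bsub>M\<^esub>, Some \<one>\<^bsub>M\<^esub>], (2, 2, [1 \<mapsto> 2, 2 \<mapsto> 1])) \<and>
     \<Phi> (gen X EdgeU) = ([None], (1, 0, Map.empty)) \<and>
     \<Phi> (gen X EdgeV) = ([], (0, 1, Map.empty)) \<and>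
     (\<forall>x\<in>X. \<Phi> (gen X (Letter x)) = ([Some (\<phi> [x])], (1, 1, [1 \<mapsto> 1])))"

end

theory Submission
  imports Defs
begin

text \<open>
  A morphism of \<open>M \<wr> \<I>\<close> is drawn as a bundle of strands labelled by elements of \<open>M\<close>: \<open>X\<close> swaps two
  adjacent strands, \<open>U\<close> ends a strand, \<open>V\<close> starts one, and a letter puts a label on a strand. The
  relations are easily seen to hold, so the question is why they suffice. They suffice because they
  bring every term into a normal form that can be read off from the morphism that the term names.

  The normal form is built from the left: either the first strand of the domain dies, or it takes its
  label and is carried past \<open>p\<close> others to its endpoint, after the remaining strands, with that endpoint
  deleted, have been brought into normal form. The list of these decisions is called a code. When all
  strands of the domain have been used up, new strands start at the remaining points of the codomain.

  In every tensor category in which the relations hold, each term has the same value as some code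
  (\<open>interp_eq_code\<close>). The reason is that codes can be multiplied from the right by an edge tensored with
  identities (\<open>code_layer\<close>). The edge either misses the first strand, and then it can be moved past it
  by naturality of the crossing and acts on the rest of the code, or it hits the endpoint of that
  strand, and then it changes only the first entry of the code (\<open>cycle_layer_cases\<close>).

  In \<open>M \<wr> \<I>\<close> itself every morphism is the value of a code (\<open>code_surj\<close>), and the code is unique up to
  replacing words by words that are equal in \<open>M\<close> (\<open>code_unique\<close>). Such words are related by the
  relations of \<open>M\<close>. To conclude (\<open>kernel_least\<close>), the first fact is applied in the quotient of the free
  tensor category by a congruence that contains the relations and is sound for \<open>M \<wr> \<I>\<close>: two terms
  with the same image in \<open>M \<wr> \<I>\<close> have codes with the same image, hence codes that are congruent, and so they are congruent
  themselves.
\<close>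


section \<open>Evaluating terms in a tensor category\<close>

context tensor_category
begin

lemmas typing [simp] =
  ident_closed src_ident rng_ident comp_closed src_comp rng_comp tens_closed src_tens rng_tens

lemma ident_comp' [simp]: "\<lbrakk>a \<in> mors C; src C a = n\<rbrakk> \<Longrightarrow> ident C n \<odot> a = a"
  using ident_comp by blast

lemma comp_ident' [simp]: "\<lbrakk>a \<in> mors C; rng C a = n\<rbrakk> \<Longrightarrow> a \<odot> ident C n = a"
  using comp_ident by blast

declare unit_tens [simp] tens_unit [simp] ident_tens [simp]

end

primrec interp :: "'a tensor_cat \<Rightarrow> ('e \<Rightarrow> 'a) \<Rightarrow> 'e trm \<Rightarrow> 'a" where
  "interp C g (Ident n) = ident C n"
| "interp C g (Edge e) = g e"
| "interp C g (Comp s t) = interp C g s \<odot>\<^bsub>C\<^esub> interp C g t"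
| "interp C g (Tens s t) = interp C g s \<oplus>\<^bsub>C\<^esub> interp C g t"

locale edge_assignment = tensor_category C
  for C :: "'a tensor_cat" (structure) +
  fixes G :: "(nat, 'e) pre_digraph" and g :: "'e \<Rightarrow> 'a"
  assumes edge_closed [simp]: "e \<in> arcs G \<Longrightarrow> g e \<in> mors C"
    and src_edge [simp]: "e \<in> arcs G \<Longrightarrow> src C (g e) = tail G e"
    and rng_edge [simp]: "e \<in> arcs G \<Longrightarrow> rng C (g e) = head G e"
begin

lemma interp_typing [simp]:
  assumes "wf_trm G t"
  shows "interp C g t \<in> mors C" "src C (interp C g t) = trm_src G t" "rng C (interp C g t) = trm_rng G t"
proof -
  from assms have "interp C g t \<in> mors C \<and> src C (interp C g t) = trm_src G t \<and> rng C (interp C g t) = trm_rng G t"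
    by (induction t) auto
  then show "interp C g t \<in> mors C" "src C (interp C g t) = trm_src G t" "rng C (interp C g t) = trm_rng G t"
    by auto
qed

end

lemma trm_eq_parallel:
  assumes "trm_eq G s t"
  shows "wf_trm G s \<and> wf_trm G t \<and> trm_src G s = trm_src G t \<and> trm_rng G s = trm_rng G t"
  using assms by induction auto

lemma (in edge_assignment) interp_respects_trm_eq:
  assumes "trm_eq G s t"
  shows "interp C g s = interp C g t"
  using assms
proof induction
  case (cong_Comp s s' t t') then show ?case by simp
next
  case (Comp_assoc s t u) then show ?case by (simp add: comp_assoc)
next
  case (Tens_assoc s t u) then show ?case by (simp add: tens_assoc)
next
  case (Interchange s t u v) then show ?case by (simp add: interchange)
qed auto


section \<open>The universal property of the free tensor category\<close>

lemma equiv_trm_rel: "equiv {t. wf_trm G t} (trm_rel G)"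
proof (rule equivI)
  show "trm_rel G \<subseteq> {t. wf_trm G t} \<times> {t. wf_trm G t}"
    using trm_eq_parallel by (auto simp: trm_rel_def)
  show "refl_on {t. wf_trm G t} (trm_rel G)"
    by (simp add: refl_on_def trm_rel_def trm_eq.refl)
  show "sym (trm_rel G)"
    by (auto simp: sym_def trm_rel_def trm_eq.sym)
  show "trans (trm_rel G)"
    by (auto simp: trans_def trm_rel_def elim: trm_eq.trans)
qed

lemma trm_class_eq: "trm_eq G s t \<Longrightarrow> trm_class G s = trm_class G t"
  unfolding trm_class_def using equiv_class_eq[OF equiv_trm_rel] by (auto simp: trm_rel_def)

lemma mem_trm_class: "s \<in> trm_class G t \<longleftrightarrow> trm_eq G t s"
  by (simp add: trm_class_def trm_rel_def)

lemma trm_class_self: "wf_trm G t \<Longrightarrow> t \<in> trm_class G t"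
  by (simp add: mem_trm_class trm_eq.refl)

lemma mors_free: "mors (free_tensor_category G) = trm_class G ` {t. wf_trm G t}"
  by (auto simp: free_tensor_category_def quotient_def trm_class_def)

lemma free_cases:
  assumes "A \<in> mors (free_tensor_category G)"
  obtains t where "wf_trm G t" "A = trm_class G t"
  using assms by (auto simp: mors_free)

lemma free_closed [simp]: "wf_trm G t \<Longrightarrow> trm_class G t \<in> mors (free_tensor_category G)"
  by (auto simp: mors_free)

lemma free_ident: "ident (free_tensor_category G) n = trm_class G (Ident n)"
  by (simp add: free_tensor_category_def)

lemma free_src [simp]: 
  assumes "wf_trm G t"
  shows "src (free_tensor_category G) (trm_class G t) = trm_src G t"
proof -
  have "trm_src G ` trm_class G t = {trm_src G t}"
    using imageI[OF trm_class_self[OF assms], of "trm_src G"]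
    by (auto simp: mem_trm_class dest!: trm_eq_parallel)
  then show ?thesis by (simp add: free_tensor_category_def)
qed

lemma free_rng [simp]: 
  assumes "wf_trm G t"
  shows "rng (free_tensor_category G) (trm_class G t) = trm_rng G t"
proof -
  have "trm_rng G ` trm_class G t = {trm_rng G t}"
    using imageI[OF trm_class_self[OF assms], of "trm_rng G"]
    by (auto simp: mem_trm_class dest!: trm_eq_parallel)
  then show ?thesis by (simp add: free_tensor_category_def)
qed

lemma free_comp [simp]:
  assumes "wf_trm G s" "wf_trm G t" "trm_rng G s = trm_src G t"
  shows "trm_class G s \<odot>\<^bsub>free_tensor_category G\<^esub> trm_class G t = trm_class G (Comp s t)"
proof -
  have "trm_class G (Comp s' t') = trm_class G (Comp s t)"
    if "s' \<in> trm_class G s" "t' \<in> trm_class G t" for s' t'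
    using that assms by (metis mem_trm_class trm_class_eq trm_eq.cong_Comp)
  moreover have "s \<in> trm_class G s" "t \<in> trm_class G t"
    using assms by (simp_all add: trm_class_self)
  ultimately have "(\<Union>s'\<in>trm_class G s. \<Union>t'\<in>trm_class G t. trm_class G (Comp s' t')) = trm_class G (Comp s t)"
    by (intro SUP_eq_const) blast+
  then show ?thesis by (simp add: free_tensor_category_def)
qed

lemma free_tens [simp]:
  assumes "wf_trm G s" "wf_trm G t"
  shows "trm_class G s \<oplus>\<^bsub>free_tensor_category G\<^esub> trm_class G t = trm_class G (Tens s t)"
proof -
  have "trm_class G (Tens s' t') = trm_class G (Tens s t)"
    if "s' \<in> trm_class G s" "t' \<in> trm_class G t" for s' t'
    using that assms by (metis mem_trm_class trm_class_eq trm_eq.cong_Tens)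
  moreover have "s \<in> trm_class G s" "t \<in> trm_class G t"
    using assms by (simp_all add: trm_class_self)
  ultimately have "(\<Union>s'\<in>trm_class G s. \<Union>t'\<in>trm_class G t. trm_class G (Tens s' t')) = trm_class G (Tens s t)"
    by (intro SUP_eq_const) blast+
  then show ?thesis by (simp add: free_tensor_category_def)
qed

lemma tensor_category_free: "tensor_category (free_tensor_category G)"
proof -
  note axioms = trm_eq.Comp_assoc trm_eq.Ident_Comp trm_eq.Comp_Ident trm_eq.Tens_assoc
    trm_eq.Unit_Tens trm_eq.Tens_Unit trm_eq.Ident_Tens trm_eq.Interchange
  show ?thesis
    by unfold_locales (auto simp: free_ident mors_free axioms[THEN trm_class_eq])
qed

lemma tensor_morphism_interp:
  assumes \<Phi>: "tensor_morphism (free_tensor_category G) C \<Phi>" and "wf_trm G t"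
  shows "\<Phi> (trm_class G t) = interp C (\<lambda>e. \<Phi> (trm_class G (Edge e))) t"
  using assms(2)
proof (induction t)
  case (Ident n)
  then show ?case using \<Phi> by (simp add: tensor_morphism_def free_ident)
next
  case (Comp s t)
  then have "\<Phi> (trm_class G (Comp s t)) = \<Phi> (trm_class G s) \<odot>\<^bsub>C\<^esub> \<Phi> (trm_class G t)"
    using \<Phi> free_comp[of G s t] unfolding tensor_morphism_def 
    by (metis (lifting) free_closed free_rng free_src wf_trm.simps(3))
  with Comp show ?case by simp
next
  case (Tens s t)
  then have "\<Phi> (trm_class G (Tens s t)) = \<Phi> (trm_class G s) \<oplus>\<^bsub>C\<^esub> \<Phi> (trm_class G t)"
    using \<Phi> free_tens[of G s t] unfolding tensor_morphism_def 
    by (metis (lifting) free_closed wf_trm.simps(4))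
  with Tens show ?case by simp
qed simp

lemma interp_cong: 
  assumes "wf_trm G t" "\<And>e. e \<in> arcs G \<Longrightarrow> g e = h e" 
  shows "interp C g t = interp C h t"
  using assms by (induction t) auto

lemma tensor_morphism_eqI:
  assumes "tensor_morphism (free_tensor_category G) C \<Phi>" "tensor_morphism (free_tensor_category G) C \<Psi>"
    and "\<And>e. e \<in> arcs G \<Longrightarrow> \<Phi> (trm_class G (Edge e)) = \<Psi> (trm_class G (Edge e))"
  shows "\<Phi> = \<Psi>"
proof (rule PiE_ext)
  show "\<Phi> \<in> mors (free_tensor_category G) \<rightarrow>\<^sub>E mors C" "\<Psi> \<in> mors (free_tensor_category G) \<rightarrow>\<^sub>E mors C"
    using assms(1,2) by (simp_all add: tensor_morphism_def)
  fix A assume "A \<in> mors (free_tensor_category G)"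
  then obtain t where t: "wf_trm G t" "A = trm_class G t" by (rule free_cases)
  then show "\<Phi> A = \<Psi> A"
    using interp_cong[OF t(1) assms(3)]
    by (simp add: tensor_morphism_interp[OF assms(1)] tensor_morphism_interp[OF assms(2)])
qed

text \<open>
  The values of \<open>g\<close> on the edges extend to a functor, since interpretation does not distinguish
  terms that the axioms of tensor categories identify; any representative of a class will do.
\<close>

definition free_lift :: "'a tensor_cat \<Rightarrow> (nat, 'e) pre_digraph \<Rightarrow> ('e \<Rightarrow> 'a) \<Rightarrow> 'e trm set \<Rightarrow> 'a" where
  "free_lift C G g = (\<lambda>A\<in>mors (free_tensor_category G). interp C g (SOME t. t \<in> A))"

context edge_assignment
begin

lemma free_lift_class [simp]:
  assumes "wf_trm G t"
  shows "free_lift C G g (trm_class G t) = interp C g t"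
proof -
  have "(SOME s. s \<in> trm_class G t) \<in> trm_class G t"
    using trm_class_self[OF assms] by (rule someI)
  then have "interp C g t = interp C g (SOME s. s \<in> trm_class G t)"
    by (simp add: mem_trm_class interp_respects_trm_eq)
  then show ?thesis using assms by (simp add: free_lift_def)
qed

lemma tensor_morphism_free_lift: "tensor_morphism (free_tensor_category G) C (free_lift C G g)"
proof -
  have "free_lift C G g \<in> mors (free_tensor_category G) \<rightarrow>\<^sub>E mors C"
    by (rule PiE_I) (auto simp: mors_free, auto simp: free_lift_def mors_free)
  then show ?thesis
    unfolding tensor_morphism_def by (auto simp: mors_free free_ident)
qed

end


section \<open>Quotients by tensor congruences\<close>

text \<open>
  The morphisms of the quotient are not congruence classes but one chosen representative of each
  class. Sources and ranges are then those of the original category, and an equation in the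
  quotient between representatives of \<open>a\<close> and \<open>b\<close> says exactly that \<open>a\<close> and \<open>b\<close> are congruent.
\<close>

definition congruence_rep :: "('a \<times> 'a) set \<Rightarrow> 'a \<Rightarrow> 'a" where
  "congruence_rep r a = (SOME b. (a, b) \<in> r)"

definition quotient_category :: "'a tensor_cat \<Rightarrow> ('a \<times> 'a) set \<Rightarrow> 'a tensor_cat" where
  "quotient_category C r =
     \<lparr>mors = congruence_rep r ` mors C, src = src C, rng = rng C,
      ident = (\<lambda>n. congruence_rep r (ident C n)),
      tcomp = (\<lambda>a b. congruence_rep r (a \<odot>\<^bsub>C\<^esub> b)),
      tens = (\<lambda>a b. congruence_rep r (a \<oplus>\<^bsub>C\<^esub> b))\<rparr>"

locale quotient_by_congruence = tensor_category C
  for C :: "'a tensor_cat" (structure) +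
  fixes r :: "('a \<times> 'a) set"
  assumes r: "tensor_congruence C r"
begin

abbreviation "rep \<equiv> congruence_rep r"
abbreviation "Q \<equiv> quotient_category C r"

lemma equiv_r: "equiv (mors C) r"
  using r by (simp add: tensor_congruence_def)

lemma r_parallel:
  "(a, b) \<in> r \<Longrightarrow> a \<in> mors C \<and> b \<in> mors C \<and> src C a = src C b \<and> rng C a = rng C b"
  using r by (auto simp: tensor_congruence_def parallel_pairs_def)

lemma r_refl: "a \<in> mors C \<Longrightarrow> (a, a) \<in> r"
  using equiv_class_self[OF equiv_r] by blast

lemma rep_related: "a \<in> mors C \<Longrightarrow> (a, rep a) \<in> r"
  unfolding congruence_rep_def by (rule someI[of "\<lambda>b. (a, b) \<in> r", OF r_refl])

lemma rep_eq_iff: 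
  assumes "a \<in> mors C" "b \<in> mors C" 
  shows "rep a = rep b \<longleftrightarrow> (a, b) \<in> r"
proof
  show "rep a = rep b \<Longrightarrow> (a, b) \<in> r"
    using rep_related[OF assms(1)] rep_related[OF assms(2)] equiv_r
    by (metis equivE symE transE)
  assume "(a, b) \<in> r"
  then have "r `` {a} = r `` {b}" by (rule equiv_class_eq[OF equiv_r])
  then have "(a, x) \<in> r \<longleftrightarrow> (b, x) \<in> r" for x by (simp add: set_eq_iff)
  then show "rep a = rep b" by (simp add: congruence_rep_def)
qed

lemma rep_typing [simp]:
  assumes "a \<in> mors C"
  shows "rep a \<in> mors C" "src C (rep a) = src C a" "rng C (rep a) = rng C a"
  using r_parallel[OF rep_related[OF assms]] by auto

lemma rep_rep [simp]: "a \<in> mors C \<Longrightarrow> rep (rep a) = rep a"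
  using rep_related[of a] by (simp add: rep_eq_iff[symmetric])

lemma r_one_sided:
  assumes "(a, b) \<in> r" "c \<in> mors C"
  shows "rng C c = src C a \<Longrightarrow> (c \<odot> a, c \<odot> b) \<in> r"
    and "rng C a = src C c \<Longrightarrow> (a \<odot> c, b \<odot> c) \<in> r"
    and "(c \<oplus> a, c \<oplus> b) \<in> r" and "(a \<oplus> c, b \<oplus> c) \<in> r"
  using r assms unfolding tensor_congruence_def by (auto dest!: bspec)

lemma r_trans: "\<lbrakk>(a, b) \<in> r; (b, c) \<in> r\<rbrakk> \<Longrightarrow> (a, c) \<in> r"
  using equiv_r by (meson equivE transE)

lemma r_comp:
  assumes "(a, a') \<in> r" "(b, b') \<in> r" "rng C a = src C b"
  shows "(a \<odot> b, a' \<odot> b') \<in> r"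
proof (rule r_trans)
  show "(a \<odot> b, a' \<odot> b) \<in> r" "(a' \<odot> b, a' \<odot> b') \<in> r"
    using assms r_parallel[OF assms(1)] r_parallel[OF assms(2)] by (simp_all add: r_one_sided)
qed

lemma r_tens:
  assumes "(a, a') \<in> r" "(b, b') \<in> r"
  shows "(a \<oplus> b, a' \<oplus> b') \<in> r"
proof (rule r_trans)
  show "(a \<oplus> b, a' \<oplus> b) \<in> r" "(a' \<oplus> b, a' \<oplus> b') \<in> r"
    using assms r_parallel[OF assms(1)] r_parallel[OF assms(2)] by (simp_all add: r_one_sided)
qed

lemma rep_related': "a \<in> mors C \<Longrightarrow> (rep a, a) \<in> r"
  using rep_related equiv_r by (meson equivE symD)

lemma rep_comp [simp]:
  assumes "a \<in> mors C" "b \<in> mors C" "rng C a = src C b"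
  shows "rep (rep a \<odot> b) = rep (a \<odot> b)" "rep (a \<odot> rep b) = rep (a \<odot> b)"
  using assms by (simp_all add: rep_eq_iff r_comp r_refl rep_related')

lemma rep_tens [simp]:
  assumes "a \<in> mors C" "b \<in> mors C"
  shows "rep (rep a \<oplus> b) = rep (a \<oplus> b)" "rep (a \<oplus> rep b) = rep (a \<oplus> b)"
  using assms by (simp_all add: rep_eq_iff r_tens r_refl rep_related')

lemma quotient_simps:
  "mors Q = rep ` mors C" "src Q = src C" "rng Q = rng C" "ident Q n = rep (ident C n)"
  "a \<odot>\<^bsub>Q\<^esub> b = rep (a \<odot> b)" "a \<oplus>\<^bsub>Q\<^esub> b = rep (a \<oplus> b)"
  by (simp_all add: quotient_category_def)

lemma tensor_category_quotient: "tensor_category Q"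
  by unfold_locales
    (auto simp: quotient_simps comp_assoc tens_assoc interchange)

lemma tensor_morphism_rep: "tensor_morphism C Q (restrict rep (mors C))"
  by (auto simp: tensor_morphism_def quotient_simps)

end


section \<open>Codes of wreath product morphisms\<close>

text \<open>
  A code describes a morphism from \<open>length c\<close> to \<open>n\<close> strand by strand. An entry \<^term>\<open>None\<close> is a
  strand that dies. An entry \<^term>\<open>Some (w, p)\<close> is a strand that carries the word \<open>w\<close> and ends with
  \<open>p\<close> positions to its left; its endpoint is then deleted, and the rest of the code describes a
  morphism to \<open>n - 1\<close>, so that the positions form a Lehmer code. New strands
  start at the positions of the codomain that are left over.
\<close>

primrec word_term :: "'x list \<Rightarrow> 'x edge trm" where
  "word_term [] = Ident 1"
| "word_term (x # w) = Comp (Edge (Letter x)) (word_term w)"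

text \<open>
  The first of \<open>p + 1\<close> strands is carried past the other \<open>p\<close>, whose order is kept.
\<close>

primrec cycle_term :: "nat \<Rightarrow> 'x edge trm" where
  "cycle_term 0 = Ident 1"
| "cycle_term (Suc p) = Comp (Tens (cycle_term p) (Ident 1)) (Tens (Ident p) (Edge EdgeX))"

primrec births_term :: "nat \<Rightarrow> 'x edge trm" where
  "births_term 0 = Ident 0"
| "births_term (Suc n) = Tens (Edge EdgeV) (births_term n)"

type_synonym 'x code = "('x list \<times> nat) option list"

fun code_term :: "nat \<Rightarrow> 'x code \<Rightarrow> 'x edge trm" where
  "code_term n [] = births_term n"
| "code_term n (None # c) = Tens (Edge EdgeU) (code_term n c)"
| "code_term n (Some (w, p) # c) =
     Comp (Tens (word_term w) (code_term (n - 1) c)) (Tens (cycle_term p) (Ident (n - 1 - p)))"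

fun valid_code :: "'x set \<Rightarrow> nat \<Rightarrow> 'x code \<Rightarrow> bool" where
  "valid_code X n [] \<longleftrightarrow> True"
| "valid_code X n (None # c) \<longleftrightarrow> valid_code X n c"
| "valid_code X n (Some (w, p) # c) \<longleftrightarrow> w \<in> lists X \<and> p < n \<and> valid_code X (n - 1) c"

lemma wreath_digraph_simps [simp]:
  "arcs (wreath_digraph X) = {EdgeX, EdgeU, EdgeV} \<union> Letter ` X"
  "tail (wreath_digraph X) EdgeX = 2" "head (wreath_digraph X) EdgeX = 2"
  "tail (wreath_digraph X) EdgeU = 1" "head (wreath_digraph X) EdgeU = 0"
  "tail (wreath_digraph X) EdgeV = 0" "head (wreath_digraph X) EdgeV = 1"
  "tail (wreath_digraph X) (Letter x) = 1" "head (wreath_digraph X) (Letter x) = 1"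
  by (simp_all add: wreath_digraph_def)

lemma word_term_typing [simp]:
  "wf_trm (wreath_digraph X) (word_term w) \<longleftrightarrow> w \<in> lists X"
  "trm_src (wreath_digraph X) (word_term w) = 1"
  "trm_rng (wreath_digraph X) (word_term w) = 1"
proof -
  show s: "trm_src (wreath_digraph X) (word_term w) = 1" for w by (cases w) simp_all
  show "trm_rng (wreath_digraph X) (word_term w) = 1" by (induction w) simp_all
  show "wf_trm (wreath_digraph X) (word_term w) \<longleftrightarrow> w \<in> lists X" by (induction w) (auto simp: s)
qed

lemma cycle_term_typing [simp]:
  "wf_trm (wreath_digraph X) (cycle_term p)"
  "trm_src (wreath_digraph X) (cycle_term p) = Suc p"
  "trm_rng (wreath_digraph X) (cycle_term p) = Suc p"
proof -
  have "wf_trm (wreath_digraph X) (cycle_term p) \<and> trm_src (wreath_digraph X) (cycle_term p) = Suc p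
    \<and> trm_rng (wreath_digraph X) (cycle_term p) = Suc p"
    by (induction p) simp_all
  then show "wf_trm (wreath_digraph X) (cycle_term p)"
    "trm_src (wreath_digraph X) (cycle_term p) = Suc p"
    "trm_rng (wreath_digraph X) (cycle_term p) = Suc p" by auto
qed

lemma births_term_typing [simp]:
  "wf_trm (wreath_digraph X) (births_term n)"
  "trm_src (wreath_digraph X) (births_term n) = 0"
  "trm_rng (wreath_digraph X) (births_term n) = n"
  by (induction n) simp_all

lemma code_term_typing [simp]:
  assumes "valid_code X n c"
  shows "wf_trm (wreath_digraph X) (code_term n c)"
    "trm_src (wreath_digraph X) (code_term n c) = length c"
    "trm_rng (wreath_digraph X) (code_term n c) = n"
proof -
  have "wf_trm (wreath_digraph X) (code_term n c) \<and> trm_src (wreath_digraph X) (code_term n c) = length c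
    \<and> trm_rng (wreath_digraph X) (code_term n c) = n"
    using assms by (induction X n c rule: valid_code.induct) auto
  then show "wf_trm (wreath_digraph X) (code_term n c)"
    "trm_src (wreath_digraph X) (code_term n c) = length c"
    "trm_rng (wreath_digraph X) (code_term n c) = n" by auto
qed


section \<open>Reduction to codes\<close>

context tensor_category
begin

abbreviation \<iota> where "\<iota> \<equiv> ident C"
abbreviation I where "I \<equiv> \<iota> (Suc 0)"

lemma whisker_left:
  "\<lbrakk>a \<in> mors C; b \<in> mors C; rng C a = src C b\<rbrakk> \<Longrightarrow> \<iota> n \<oplus> a \<odot> b = (\<iota> n \<oplus> a) \<odot> (\<iota> n \<oplus> b)"
  using interchange[of "\<iota> n" "\<iota> n" a b] by simp

lemma whisker_right:
  "\<lbrakk>a \<in> mors C; b \<in> mors C; rng C a = src C b\<rbrakk> \<Longrightarrow> a \<odot> b \<oplus> \<iota> n = (a \<oplus> \<iota> n) \<odot> (b \<oplus> \<iota> n)"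
  using interchange[of a b "\<iota> n" "\<iota> n"] by simp

text \<open>
  Morphisms on disjoint groups of strands commute: either factor may be performed first.
\<close>

lemma tens_eq_comp:
  assumes "a \<in> mors C" "b \<in> mors C"
  shows "a \<oplus> b = (a \<oplus> \<iota> (src C b)) \<odot> (\<iota> (rng C a) \<oplus> b)"
    and "a \<oplus> b = (\<iota> (src C a) \<oplus> b) \<odot> (a \<oplus> \<iota> (rng C b))"
  using assms by (simp_all add: interchange[symmetric])

lemma ident_Suc: "\<iota> (Suc n) = \<iota> n \<oplus> I"
  by simp_all

end

text \<open>
  All defining relations but those of the monoid, on the level of terms.
\<close>

inductive_set structural_relations :: "'x set \<Rightarrow> ('x edge trm \<times> 'x edge trm) set" for X where
  "(Comp (Edge EdgeX) (Edge EdgeX), Ident 2) \<in> structural_relations X"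
| "(Comp (Comp (Tens (Edge EdgeX) (Ident 1)) (Tens (Ident 1) (Edge EdgeX))) (Tens (Edge EdgeX) (Ident 1)),
    Comp (Comp (Tens (Ident 1) (Edge EdgeX)) (Tens (Edge EdgeX) (Ident 1))) (Tens (Ident 1) (Edge EdgeX)))
    \<in> structural_relations X"
| "(Comp (Edge EdgeV) (Edge EdgeU), Ident 0) \<in> structural_relations X"
| "(Comp (Edge EdgeX) (Tens (Edge EdgeU) (Ident 1)), Tens (Ident 1) (Edge EdgeU)) \<in> structural_relations X"
| "(Comp (Tens (Edge EdgeV) (Ident 1)) (Edge EdgeX), Tens (Ident 1) (Edge EdgeV)) \<in> structural_relations X"
| "x \<in> X \<Longrightarrow> (Comp (Edge EdgeX) (Tens (Edge (Letter x)) (Ident 1)),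
    Comp (Tens (Ident 1) (Edge (Letter x))) (Edge EdgeX)) \<in> structural_relations X"
| "x \<in> X \<Longrightarrow> (Comp (Edge (Letter x)) (Edge EdgeU), Edge EdgeU) \<in> structural_relations X"
| "x \<in> X \<Longrightarrow> (Comp (Edge EdgeV) (Edge (Letter x)), Edge EdgeV) \<in> structural_relations X"

locale wreath_model = edge_assignment C "wreath_digraph X" g
  for C :: "'a tensor_cat" (structure) and X :: "'x set" and g :: "'x edge \<Rightarrow> 'a" +
  assumes relation_holds: "(s, t) \<in> structural_relations X \<Longrightarrow> interp C g s = interp C g t"
begin

abbreviation T where "T \<equiv> g EdgeX"
abbreviation U where "U \<equiv> g EdgeU"
abbreviation V where "V \<equiv> g EdgeV"
abbreviation ev where "ev \<equiv> interp C g"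
abbreviation cyc where "cyc p \<equiv> ev (cycle_term p)"

lemma
  shows swap_swap: "T \<odot> T = \<iota> 2"
    and braid: "(T \<oplus> I) \<odot> (I \<oplus> T) \<odot> (T \<oplus> I) = (I \<oplus> T) \<odot> (T \<oplus> I) \<odot> (I \<oplus> T)"
    and birth_death: "V \<odot> U = \<iota> 0"
    and swap_death: "T \<odot> (U \<oplus> I) = I \<oplus> U"
    and birth_swap: "(V \<oplus> I) \<odot> T = I \<oplus> V"
    and swap_letter: "x \<in> X \<Longrightarrow> T \<odot> (g (Letter x) \<oplus> I) = (I \<oplus> g (Letter x)) \<odot> T"
    and letter_death: "x \<in> X \<Longrightarrow> g (Letter x) \<odot> U = U"
    and birth_letter: "x \<in> X \<Longrightarrow> V \<odot> g (Letter x) = V"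
  using structural_relations.intros[where X = X, THEN relation_holds] by simp_all

lemma swap_swap_cancel: "\<lbrakk>a \<in> mors C; src C a = 2\<rbrakk> \<Longrightarrow> T \<odot> (T \<odot> a) = a"
  by (simp add: comp_assoc[symmetric] swap_swap)

text \<open>
  The swap is an involution, so each relation that moves an edge across it in one direction also
  moves the edge back.
\<close>

lemma swap_death': "T \<odot> (I \<oplus> U) = U \<oplus> I"
proof -
  have "T \<odot> (I \<oplus> U) = T \<odot> (T \<odot> (U \<oplus> I))" by (simp add: swap_death)
  then show ?thesis by (simp add: swap_swap_cancel)
qed

lemma swap_letter': 
  assumes "x \<in> X"
  shows "T \<odot> (I \<oplus> g (Letter x)) = (g (Letter x) \<oplus> I) \<odot> T"
proof -
  have "T \<odot> (I \<oplus> g (Letter x)) = T \<odot> ((I \<oplus> g (Letter x)) \<odot> T) \<odot> T"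
    using assms by (simp add: comp_assoc swap_swap)
  also have "\<dots> = T \<odot> (T \<odot> (g (Letter x) \<oplus> I)) \<odot> T"
    by (simp only: swap_letter[OF assms])
  finally show ?thesis using assms by (simp add: swap_swap_cancel)
qed

lemma cyc_add: "cyc (m + n) = (cyc m \<oplus> \<iota> n) \<odot> (\<iota> m \<oplus> cyc n)"
proof (induction n)
  case (Suc n)
  have "cyc (m + Suc n) = ((cyc m \<oplus> \<iota> n) \<odot> (\<iota> m \<oplus> cyc n) \<oplus> I) \<odot> (\<iota> m \<oplus> \<iota> n \<oplus> T)"
    using Suc by simp
  also have "\<dots> = (cyc m \<oplus> \<iota> n \<oplus> I) \<odot> ((\<iota> m \<oplus> (cyc n \<oplus> I)) \<odot> (\<iota> m \<oplus> (\<iota> n \<oplus> T)))"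
    by (simp add: whisker_right tens_assoc comp_assoc del: ident_tens)
  also have "\<dots> = (cyc m \<oplus> (\<iota> n \<oplus> I)) \<odot> (\<iota> m \<oplus> cyc (Suc n))"
    by (simp add: whisker_left tens_assoc del: ident_tens)
  finally show ?case by simp
qed simp

text \<open>
  Naturality of the cycle: a strand can be carried past \<open>s\<close> either before or after \<open>s\<close> is performed.
  The property is stable under tensor products, so that it has to be checked only for the edges, for
  which it is one of the defining relations or the mirror image of one.
\<close>

definition passes :: "'a \<Rightarrow> bool" where
  "passes s \<longleftrightarrow> s \<in> mors C \<and> cyc (src C s) \<odot> (s \<oplus> I) = (I \<oplus> s) \<odot> cyc (rng C s)"

lemma passes_ident: "passes (\<iota> n)"
  by (simp add: passes_def)

lemma passes_tens:
  assumes "passes s" "passes t"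
  shows "passes (s \<oplus> t)"
proof -
  define m m' n n' where "m = src C s" "m' = rng C s" "n = src C t" "n' = rng C t"
  note [simp] = m_m'_n_n'_def[symmetric]
  have s [simp]: "s \<in> mors C" and t [simp]: "t \<in> mors C"
    using assms by (simp_all add: passes_def)
  have ps: "cyc m \<odot> (s \<oplus> I) = (I \<oplus> s) \<odot> cyc m'" and pt: "cyc n \<odot> (t \<oplus> I) = (I \<oplus> t) \<odot> cyc n'"
    using assms by (simp_all add: passes_def)
  have "cyc (m + n) \<odot> (s \<oplus> t \<oplus> I) = (cyc m \<oplus> \<iota> n) \<odot> ((\<iota> m \<oplus> cyc n) \<odot> (s \<oplus> (t \<oplus> I)))"
    by (simp add: cyc_add comp_assoc tens_assoc)
  also have "(\<iota> m \<oplus> cyc n) \<odot> (s \<oplus> (t \<oplus> I)) = s \<oplus> (I \<oplus> t) \<odot> cyc n'"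
    by (simp add: interchange[symmetric] pt)
  also have "\<dots> = (s \<oplus> I \<oplus> t) \<odot> (\<iota> m' \<oplus> cyc n')"
    using interchange[of s "\<iota> m'" "I \<oplus> t" "cyc n'"] by (simp add: tens_assoc)
  also have "(cyc m \<oplus> \<iota> n) \<odot> ((s \<oplus> I \<oplus> t) \<odot> (\<iota> m' \<oplus> cyc n'))
      = (cyc m \<odot> (s \<oplus> I) \<oplus> t) \<odot> (\<iota> m' \<oplus> cyc n')"
    using interchange[of "cyc m" "s \<oplus> I" "\<iota> n" t] by (simp add: comp_assoc)
  also have "\<dots> = (I \<oplus> s \<oplus> t) \<odot> ((cyc m' \<oplus> \<iota> n') \<odot> (\<iota> m' \<oplus> cyc n'))"
    using interchange[of "I \<oplus> s" "cyc m'" t "\<iota> n'"] by (simp add: comp_assoc ps)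
  finally show ?thesis by (simp add: passes_def cyc_add tens_assoc)
qed

lemma passes_edge:
  assumes "e \<in> arcs (wreath_digraph X)"
  shows "passes (g e)"
proof -
  have cyc2: "cyc 2 = (T \<oplus> I) \<odot> (I \<oplus> T)" by (simp add: numeral_2_eq_2)
  consider "e = EdgeX" | "e = EdgeU" | "e = EdgeV" | x where "x \<in> X" "e = Letter x"
    using assms by auto
  then show ?thesis
  proof cases
    case 1
    then show ?thesis using braid by (simp add: passes_def cyc2 comp_assoc)
  next
    case 2
    then show ?thesis using swap_death by (simp add: passes_def)
  next
    case 3
    have "(I \<oplus> V) \<odot> T = (V \<oplus> I) \<odot> (T \<odot> T)"
      by (simp add: birth_swap[symmetric] comp_assoc)
    then show ?thesis using 3 by (simp add: passes_def swap_swap)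
  next
    case 4
    then show ?thesis using swap_letter[of x] by (simp add: passes_def)
  qed
qed

text \<open>
  A strand that meets \<open>U\<close>, or a letter, at the end of its journey may as well meet it at the start.
\<close>

lemma cyc_death: "cyc a \<odot> (\<iota> a \<oplus> U) = U \<oplus> \<iota> a"
proof (induction a)
  case (Suc a)
  have "cyc (Suc a) \<odot> (\<iota> (Suc a) \<oplus> U) = (cyc a \<oplus> I) \<odot> (\<iota> a \<oplus> T \<odot> (I \<oplus> U))"
    by (simp add: ident_Suc[of a] comp_assoc tens_assoc whisker_left del: ident_tens)
  also have "\<dots> = (cyc a \<oplus> I) \<odot> (\<iota> a \<oplus> U \<oplus> I)"
    by (simp add: swap_death' tens_assoc)
  also have "\<dots> = U \<oplus> \<iota> a \<oplus> I"
    using whisker_right[of "cyc a" "\<iota> a \<oplus> U" 1] by (simp add: Suc)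
  finally show ?case by (simp add: tens_assoc)
qed simp

lemma cyc_letter:
  assumes "x \<in> X"
  shows "cyc a \<odot> (\<iota> a \<oplus> g (Letter x)) = (g (Letter x) \<oplus> \<iota> a) \<odot> cyc a"
proof (induction a)
  case (Suc a)
  let ?x = "g (Letter x)"
  have "cyc (Suc a) \<odot> (\<iota> (Suc a) \<oplus> ?x) = (cyc a \<oplus> I) \<odot> (\<iota> a \<oplus> T \<odot> (I \<oplus> ?x))"
    using assms by (simp add: ident_Suc[of a] comp_assoc tens_assoc whisker_left del: ident_tens)
  also have "\<dots> = (cyc a \<oplus> I) \<odot> (\<iota> a \<oplus> ?x \<oplus> I) \<odot> (\<iota> a \<oplus> T)"
    using assms by (simp add: swap_letter' tens_assoc comp_assoc whisker_left)
  also have "\<dots> = (?x \<oplus> \<iota> a \<oplus> I) \<odot> (cyc a \<oplus> I) \<odot> (\<iota> a \<oplus> T)"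
    using assms by (simp add: whisker_right[symmetric] Suc)
  finally show ?case using assms by (simp add: tens_assoc comp_assoc)
qed (use assms in simp)

lemma word_snoc: "\<lbrakk>w \<in> lists X; x \<in> X\<rbrakk> \<Longrightarrow> ev (word_term w) \<odot> g (Letter x) = ev (word_term (w @ [x]))"
  by (induction w) (auto simp: comp_assoc)

lemma word_death: "w \<in> lists X \<Longrightarrow> ev (word_term w) \<odot> U = U"
  by (induction w) (auto simp: comp_assoc letter_death)

lemma births_add: "ev (births_term (m + n)) = ev (births_term m) \<oplus> ev (births_term n)"
  by (induction m) (auto simp: tens_assoc)

abbreviation layer where "layer a e b \<equiv> \<iota> a \<oplus> g e \<oplus> \<iota> b"

text \<open>
  Strands that have just been born absorb every edge. For the swap, one of the two births is
  performed after the other, which makes the relation between \<open>V \<oplus> I\<close> and the swap applicable.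
\<close>

lemma births_layer:
  assumes "e \<in> arcs (wreath_digraph X)"
  shows "ev (births_term (a + tail (wreath_digraph X) e + b)) \<odot> layer a e b
    = ev (births_term (a + head (wreath_digraph X) e + b))"
proof -
  let ?t = "tail (wreath_digraph X) e" and ?h = "head (wreath_digraph X) e"
  have 1: "ev (births_term 1) = V" by simp
  have 2: "ev (births_term 2) = V \<oplus> V" by (simp add: numeral_2_eq_2)
  have "ev (births_term ?t) \<odot> g e = ev (births_term ?h)"
  proof -
    consider "e = EdgeX" | "e = EdgeU" | "e = EdgeV" | x where "x \<in> X" "e = Letter x"
      using assms by auto
    then show ?thesis
    proof cases
      case 1
      have "V \<oplus> V = V \<odot> (V \<oplus> I)"
        using tens_eq_comp(2)[of V V] by simp
      then have "(V \<oplus> V) \<odot> T = V \<odot> ((V \<oplus> I) \<odot> T)" by (simp add: comp_assoc)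
      also have "\<dots> = V \<oplus> V"
        using tens_eq_comp(1)[of V V] by (simp add: birth_swap)
      finally show ?thesis using 1 2 by simp
    qed (auto simp: birth_death birth_letter)
  qed
  moreover have "ev (births_term (a + ?t + b)) \<odot> layer a e b
    = (ev (births_term a) \<oplus> ev (births_term ?t) \<odot> g e) \<oplus> ev (births_term b)"
    using assms by (simp add: births_add interchange[symmetric])
  ultimately show ?thesis by (simp add: births_add)
qed


text \<open>
  A strand travels to position \<open>p + 1\<close>, and an edge is performed at the positions \<open>a + 1, \<dots>\<close>
  afterwards. If the strand ends beside the edge, the edge can be performed first, on the remaining
  strands. If it ends on the edge, then the edge kills it, labels it, or lengthens or shortens its
  journey by one step.
\<close>

lemma cycle_layer_cases:
  assumes e: "e \<in> arcs (wreath_digraph X)"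
    and k: "Suc k = a + tail (wreath_digraph X) e + b" and p: "p \<le> k"
  obtains
    (passing) a' b' k' p' where "k = a' + tail (wreath_digraph X) e + b'"
      "k' = a' + head (wreath_digraph X) e + b'" "Suc k' = a + head (wreath_digraph X) e + b" "p' \<le> k'"
      "(cyc p \<oplus> \<iota> (k - p)) \<odot> layer a e b = (I \<oplus> layer a' e b') \<odot> (cyc p' \<oplus> \<iota> (k' - p'))"
  | (death) "e = EdgeU" "(cyc p \<oplus> \<iota> (k - p)) \<odot> layer a e b = U \<oplus> \<iota> k"
  | (letter) x where "x \<in> X" "e = Letter x"
      "(cyc p \<oplus> \<iota> (k - p)) \<odot> layer a e b = (g e \<oplus> \<iota> k) \<odot> (cyc p \<oplus> \<iota> (k - p))"
  | (swap) p' where "e = EdgeX" "p' \<le> k"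
      "(cyc p \<oplus> \<iota> (k - p)) \<odot> layer a e b = cyc p' \<oplus> \<iota> (k - p')"
proof -
  let ?t = "tail (wreath_digraph X) e" and ?h = "head (wreath_digraph X) e"
  note [simp] = edge_closed[OF e] src_edge[OF e] rng_edge[OF e]
  consider (left) "p < a" | (right) "a + ?t \<le> p" | (meet) "a \<le> p" "p < a + ?t" by linarith
  then show thesis
  proof cases
    case left
    then obtain d where a: "a = Suc p + d" by (metis Suc_leI le_Suc_ex)
    have q: "k - p = d + ?t + b" using k a by simp
    have "layer a e b = \<iota> (Suc p) \<oplus> layer d e b"
      unfolding a by (simp only: ident_tens[symmetric]) (simp add: tens_assoc del: ident_tens)
    then have "(cyc p \<oplus> \<iota> (k - p)) \<odot> layer a e b = cyc p \<oplus> layer d e b"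
      by (simp add: q interchange[symmetric])
    moreover have "I \<oplus> layer (p + d) e b = \<iota> (Suc p) \<oplus> layer d e b"
    proof -
      have "\<iota> (Suc p) = I \<oplus> \<iota> p" "\<iota> (p + d) = \<iota> p \<oplus> \<iota> d" by simp_all
      then show ?thesis by (simp add: tens_assoc del: ident_tens)
    qed
    then have "(I \<oplus> layer (p + d) e b) \<odot> (cyc p \<oplus> \<iota> (d + ?h + b)) = cyc p \<oplus> layer d e b"
      by (simp add: interchange[symmetric])
    ultimately show thesis
      using passing[of "p + d" b "p + d + ?h + b" p] a k by (simp add: add.assoc)
  next
    case right
    then obtain d where p': "p = a + ?t + d" by (metis le_Suc_ex)
    define q where "q = k - p"
    have b: "b = d + Suc 0 + q" using k p p' unfolding q_def by linarith
    let ?l = "layer a e d"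
    have "passes ?l"
      using passes_edge[OF e] by (simp add: passes_tens passes_ident)
    then have pass: "cyc p \<odot> (?l \<oplus> I) = (I \<oplus> ?l) \<odot> cyc (a + ?h + d)"
      by (simp add: passes_def p')
    have "layer a e b = (?l \<oplus> I) \<oplus> \<iota> q"
      unfolding b by (simp only: ident_tens[symmetric]) (simp add: tens_assoc del: ident_tens)
    then have "(cyc p \<oplus> \<iota> q) \<odot> layer a e b = cyc p \<odot> (?l \<oplus> I) \<oplus> \<iota> q"
      by (simp add: whisker_right p')
    also have "\<dots> = (I \<oplus> ?l \<oplus> \<iota> q) \<odot> (cyc (a + ?h + d) \<oplus> \<iota> q)"
      by (simp add: pass whisker_right)
    also have "I \<oplus> ?l \<oplus> \<iota> q = I \<oplus> layer a e (d + q)"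
      by (simp add: tens_assoc)
    finally show thesis
      using passing[of a "d + q" "a + ?h + d + q" "a + ?h + d"] p' k b
      by (simp add: q_def[symmetric])
  next
    case meet
    consider (X) "e = EdgeX" | (U) "e = EdgeU" | (L) x where "x \<in> X" "e = Letter x"
      using meet e by auto
    then show thesis
    proof cases
      case U
      then have [simp]: "p = a" "k = a + b" using meet k by simp_all
      have "(cyc a \<oplus> \<iota> b) \<odot> layer a e b = cyc a \<odot> (\<iota> a \<oplus> U) \<oplus> \<iota> b"
        using U by (simp add: whisker_right)
      also have "\<dots> = U \<oplus> \<iota> k" by (simp add: cyc_death tens_assoc)
      finally show thesis using death U by simp
    next
      case L
      then have [simp]: "p = a" "k = a + b" using meet k by simp_all
      have "(cyc a \<oplus> \<iota> b) \<odot> layer a e b = cyc a \<odot> (\<iota> a \<oplus> g e) \<oplus> \<iota> b"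
        using L by (simp add: whisker_right)
      also have "\<dots> = (g e \<oplus> \<iota> a) \<odot> cyc a \<oplus> \<iota> b" using L by (simp add: cyc_letter)
      also have "\<dots> = (g e \<oplus> \<iota> k) \<odot> (cyc p \<oplus> \<iota> (k - p))"
        using L by (simp add: whisker_right tens_assoc)
      finally show thesis using letter L by simp
    next
      case X
      then have k': "k = Suc a + b" using k by simp
      from X meet consider "p = a" | "p = Suc a" by fastforce
      then show thesis
      proof cases
        case 1
        have "(cyc a \<oplus> \<iota> (Suc b)) \<odot> layer a e b = (cyc a \<oplus> I) \<odot> (\<iota> a \<oplus> T) \<oplus> \<iota> b"
          using X by (simp add: whisker_right tens_assoc)
        then show thesis using swap[of "Suc a"] X 1 k' by simp
      next
        case 2
        have "(cyc (Suc a) \<oplus> \<iota> b) \<odot> layer a e b = (cyc a \<oplus> I) \<odot> ((\<iota> a \<oplus> T) \<odot> (\<iota> a \<oplus> T)) \<oplus> \<iota> b"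
          using X by (simp add: whisker_right comp_assoc)
        also have "(\<iota> a \<oplus> T) \<odot> (\<iota> a \<oplus> T) = \<iota> (a + 2)"
          by (simp add: whisker_left[symmetric] swap_swap)
        finally show thesis using swap[of a] X 2 k' by (simp add: tens_assoc)
      qed
    qed
  qed
qed

text \<open>
  By induction on the strands: an edge that misses the first strand acts on the code of the remaining
  strands, and otherwise only the first entry of the code changes.
\<close>

lemma code_layer:
  assumes e: "e \<in> arcs (wreath_digraph X)"
    and "valid_code X n c" "n = a + tail (wreath_digraph X) e + b"
  shows "\<exists>c'. length c' = length c \<and> valid_code X (a + head (wreath_digraph X) e + b) c' \<and>
    ev (code_term n c) \<odot> layer a e b = ev (code_term (a + head (wreath_digraph X) e + b) c')"
  using assms(2,3)
proof (induction c arbitrary: n a b)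
  case Nil
  then show ?case using births_layer[OF e, of a b] by (intro exI[of _ "[]"]) simp
next
  case (Cons s c)
  let ?t = "tail (wreath_digraph X) e" and ?h = "head (wreath_digraph X) e"
  note [simp] = edge_closed[OF e] src_edge[OF e] rng_edge[OF e]
  show ?case
  proof (cases s)
    case None
    with Cons.prems have c: "valid_code X n c" by simp
    from Cons.IH[OF this Cons.prems(2)] obtain c' where c': "length c' = length c"
      "valid_code X (a + ?h + b) c'" "ev (code_term n c) \<odot> layer a e b = ev (code_term (a + ?h + b) c')"
      by blast
    have "(U \<oplus> ev (code_term n c)) \<odot> layer a e b = U \<oplus> ev (code_term n c) \<odot> layer a e b"
      using interchange[of U "\<iota> 0" "ev (code_term n c)" "layer a e b"] c Cons.prems(2) by simp
    then show ?thesis using c' None by (intro exI[of _ "None # c'"]) simp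
  next
    case (Some wp)
    then obtain w p where s: "s = Some (w, p)" by (cases wp) auto
    with Cons.prems have w: "w \<in> lists X" and "p < n" and c: "valid_code X (n - 1) c" by simp_all
    then obtain k where n: "n = Suc k" and p: "p \<le> k" by (cases n) auto
    let ?w = "ev (word_term w)" and ?c = "ev (code_term k c)"
    have [simp]: "?w \<in> mors C" "src C ?w = 1" "rng C ?w = 1"
      "?c \<in> mors C" "src C ?c = length c" "rng C ?c = k"
      using w c n by simp_all
    have lhs: "ev (code_term n (s # c)) \<odot> layer a e b
        = (?w \<oplus> ?c) \<odot> ((cyc p \<oplus> \<iota> (k - p)) \<odot> layer a e b)"
      using n p s Cons.prems(2) by (simp add: comp_assoc)
    have "Suc k = a + ?t + b" using Cons.prems(2) n by simp
    from e this p show ?thesis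
    proof (cases rule: cycle_layer_cases)
      case (passing a' b' k' p')
      from Cons.IH[of k a' b'] passing(1,2) c n obtain c' where c': "length c' = length c"
        "valid_code X k' c'" "?c \<odot> layer a' e b' = ev (code_term k' c')" by auto
      have "ev (code_term n (s # c)) \<odot> layer a e b
          = (?w \<oplus> ?c) \<odot> (I \<oplus> layer a' e b') \<odot> (cyc p' \<oplus> \<iota> (k' - p'))"
        unfolding lhs passing(5)
        by (rule comp_assoc[symmetric]) (use passing(4) in \<open>simp_all add: passing(1,2)[symmetric]\<close>)
      also have "(?w \<oplus> ?c) \<odot> (I \<oplus> layer a' e b') = ?w \<oplus> ev (code_term k' c')"
        using interchange[of ?w I ?c "layer a' e b'"] by (simp add: c'(3) passing(1)[symmetric])
      finally show ?thesis
        unfolding passing(3)[symmetric] using c'(1,2) w passing(4)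
        by (intro exI[of _ "Some (w, p') # c'"]) simp
    next
      case death
      have "(?w \<oplus> ?c) \<odot> (U \<oplus> \<iota> k) = U \<oplus> ?c"
        using w by (simp add: interchange[symmetric] word_death)
      moreover have "a + ?h + b = k" using death(1) Cons.prems(2) n by simp
      ultimately show ?thesis
        unfolding lhs death(2) using c n by (intro exI[of _ "None # c"]) simp
    next
      case (letter x)
      have "(?w \<oplus> ?c) \<odot> ((g e \<oplus> \<iota> k) \<odot> (cyc p \<oplus> \<iota> (k - p)))
          = (?w \<odot> g e \<oplus> ?c) \<odot> (cyc p \<oplus> \<iota> (k - p))"
        using letter(1,2) p interchange[of ?w "g e" ?c "\<iota> k"] by (simp add: comp_assoc)
      moreover have "a + ?h + b = Suc k" using letter(2) Cons.prems(2) n by simp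
      ultimately show ?thesis
        unfolding lhs letter(3) using c n w p letter(1,2)
        by (intro exI[of _ "Some (w @ [x], p) # c"]) (simp add: word_snoc)
    next
      case (swap p')
      moreover have "a + ?h + b = Suc k" using swap(1) Cons.prems(2) n by simp
      ultimately show ?thesis
        unfolding lhs swap(3) using c n w by (intro exI[of _ "Some (w, p') # c"]) simp
    qed
  qed
qed

text \<open>
  The identities on both sides make the claim suitable for induction on the term: a tensor product of
  terms is the composite of the two factors, each one tensored with identities.
\<close>

lemma code_whiskered:
  assumes "wf_trm (wreath_digraph X) t" "valid_code X n c" "n = a + trm_src (wreath_digraph X) t + b"
  shows "\<exists>c'. length c' = length c \<and> valid_code X (a + trm_rng (wreath_digraph X) t + b) c' \<and>
    ev (code_term n c) \<odot> (\<iota> a \<oplus> ev t \<oplus> \<iota> b) = ev (code_term (a + trm_rng (wreath_digraph X) t + b) c')"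
  using assms
proof (induction t arbitrary: n c a b)
  case (Ident m)
  then show ?case by (intro exI[of _ c]) simp
next
  case (Edge e)
  then show ?case using code_layer[of e n c a b] by simp
next
  case (Comp s t)
  let ?s = "trm_rng (wreath_digraph X) s" and ?t = "trm_rng (wreath_digraph X) t"
  from Comp.IH(1)[of n c a b] Comp.prems obtain c' where c': "length c' = length c"
    "valid_code X (a + ?s + b) c'"
    "ev (code_term n c) \<odot> (\<iota> a \<oplus> ev s \<oplus> \<iota> b) = ev (code_term (a + ?s + b) c')"
    by auto
  from Comp.IH(2)[of "a + ?s + b" c' a b] Comp.prems c' obtain c'' where c'': "length c'' = length c"
    "valid_code X (a + ?t + b) c''"
    "ev (code_term (a + ?s + b) c') \<odot> (\<iota> a \<oplus> ev t \<oplus> \<iota> b) = ev (code_term (a + ?t + b) c'')"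
    by auto
  have "\<iota> a \<oplus> ev (Comp s t) \<oplus> \<iota> b = (\<iota> a \<oplus> ev s \<oplus> \<iota> b) \<odot> (\<iota> a \<oplus> ev t \<oplus> \<iota> b)"
    using Comp.prems by (simp add: whisker_left whisker_right)
  then have "ev (code_term n c) \<odot> (\<iota> a \<oplus> ev (Comp s t) \<oplus> \<iota> b)
      = ev (code_term n c) \<odot> (\<iota> a \<oplus> ev s \<oplus> \<iota> b) \<odot> (\<iota> a \<oplus> ev t \<oplus> \<iota> b)"
    using Comp.prems by (simp add: comp_assoc)
  then show ?case using c' c'' by (intro exI[of _ c'']) simp
next
  case (Tens s t)
  let ?s = "trm_rng (wreath_digraph X) s" and ?t = "trm_rng (wreath_digraph X) t"
    and ?u = "trm_src (wreath_digraph X) t"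
  from Tens.IH(1)[of n c a "?u + b"] Tens.prems obtain c' where c': "length c' = length c"
    "valid_code X (a + ?s + ?u + b) c'"
    "ev (code_term n c) \<odot> (\<iota> a \<oplus> ev s \<oplus> \<iota> (?u + b)) = ev (code_term (a + ?s + ?u + b) c')"
    by (auto simp: add.assoc)
  have "wf_trm (wreath_digraph X) t" using Tens.prems by simp
  from Tens.IH(2)[OF this c'(2) HOL.refl] obtain c'' where
    c'': "length c'' = length c'" "valid_code X (a + ?s + ?t + b) c''"
    "ev (code_term (a + ?s + ?u + b) c') \<odot> (\<iota> (a + ?s) \<oplus> ev t \<oplus> \<iota> b)
      = ev (code_term (a + ?s + ?t + b) c'')"
    by blast
  have "ev s \<oplus> ev t = (ev s \<oplus> \<iota> ?u) \<odot> (\<iota> ?s \<oplus> ev t)"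
    using tens_eq_comp(1)[of "ev s" "ev t"] Tens.prems by simp
  then have "\<iota> a \<oplus> ev (Tens s t) \<oplus> \<iota> b
      = (\<iota> a \<oplus> (ev s \<oplus> \<iota> ?u) \<oplus> \<iota> b) \<odot> (\<iota> a \<oplus> (\<iota> ?s \<oplus> ev t) \<oplus> \<iota> b)"
    using Tens.prems by (simp add: whisker_left whisker_right)
  also have "\<iota> a \<oplus> (ev s \<oplus> \<iota> ?u) \<oplus> \<iota> b = \<iota> a \<oplus> ev s \<oplus> \<iota> (?u + b)"
    using Tens.prems by (simp add: tens_assoc)
  also have "\<iota> a \<oplus> (\<iota> ?s \<oplus> ev t) \<oplus> \<iota> b = \<iota> (a + ?s) \<oplus> ev t \<oplus> \<iota> b"
    using Tens.prems by (simp only: ident_tens[symmetric]) (simp add: tens_assoc del: ident_tens)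
  finally have "ev (code_term n c) \<odot> (\<iota> a \<oplus> ev (Tens s t) \<oplus> \<iota> b)
      = ev (code_term n c) \<odot> (\<iota> a \<oplus> ev s \<oplus> \<iota> (?u + b)) \<odot> (\<iota> (a + ?s) \<oplus> ev t \<oplus> \<iota> b)"
    using Tens.prems by (simp add: comp_assoc)
  then show ?case using c' c'' by (intro exI[of _ c'']) (simp add: add.assoc)
qed

text \<open>
  Multiplying the code of an identity by a term from the right brings the term itself into code form.
\<close>

fun ident_code :: "nat \<Rightarrow> 'x code" where
  "ident_code 0 = []"
| "ident_code (Suc n) = Some ([], 0) # ident_code n"

lemma ident_code:
  "valid_code X n (ident_code n)" "length (ident_code n) = n" "ev (code_term n (ident_code n)) = \<iota> n"
  by (induction n) simp_all

theorem interp_eq_code: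
  assumes "wf_trm (wreath_digraph X) t"
  obtains c where "length c = trm_src (wreath_digraph X) t" "valid_code X (trm_rng (wreath_digraph X) t) c"
    "ev t = ev (code_term (trm_rng (wreath_digraph X) t) c)"
proof -
  let ?m = "trm_src (wreath_digraph X) t" and ?n = "trm_rng (wreath_digraph X) t"
  obtain c where "length c = ?m" "valid_code X ?n c"
    "ev (code_term ?m (ident_code ?m)) \<odot> (\<iota> 0 \<oplus> ev t \<oplus> \<iota> 0) = ev (code_term ?n c)"
    using code_whiskered[OF assms ident_code(1)[of ?m], of 0 0] by (auto simp: ident_code(2))
  then show thesis
    using assms that by (simp add: ident_code(3))
qed

end


section \<open>The wreath product is a tensor category\<close>

lemma wreath_simps:
  "src (wreath_category M) (a, m, n, \<alpha>) = m"
  "rng (wreath_category M) (a, m, n, \<alpha>) = n"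
  "ident (wreath_category M) k = (replicate k (Some \<one>\<^bsub>M\<^esub>), k, k, Some |` {1..k})"
  "(a, m, n, \<alpha>) \<odot>\<^bsub>wreath_category M\<^esub> (b, n', k, \<beta>)
    = (map2 (mult (adjoin_zero M)) a (tuple_pull (m, n, \<alpha>) b), m, k, \<beta> \<circ>\<^sub>m \<alpha>)"
  "(a, m, n, \<alpha>) \<oplus>\<^bsub>wreath_category M\<^esub> (b, k, l, \<beta>)
    = (a @ b, m + k, n + l, pmap_sum m n k \<alpha> \<beta>)"
  by (auto simp: wreath_category_def sym_inv_category_def)

lemma adjoin_zero_mult [simp]:
  "None \<otimes>\<^bsub>adjoin_zero M\<^esub> b = None" "a \<otimes>\<^bsub>adjoin_zero M\<^esub> None = None"
  "Some x \<otimes>\<^bsub>adjoin_zero M\<^esub> Some y = Some (x \<otimes>\<^bsub>M\<^esub> y)"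
  by (simp_all add: adjoin_zero_def split: option.split)

text \<open>
  Membership in the wreath product is restated coordinate by coordinate, separately for the tuple and
  for the partial map, because the axioms are verified coordinatewise. Entries of tuples are counted
  from 0 and arguments of partial maps from 1.
\<close>

definition wreath_tuple :: "('m, 's) monoid_scheme \<Rightarrow> nat \<Rightarrow> (nat \<rightharpoonup> nat) \<Rightarrow> 'm option list \<Rightarrow> bool" where
  "wreath_tuple M m \<alpha> a \<longleftrightarrow> length a = m \<and>
     (\<forall>i<m. a ! i \<in> insert None (Some ` carrier M) \<and> (a ! i = None \<longleftrightarrow> \<alpha> (Suc i) = None))"

definition partial_injection :: "nat \<Rightarrow> nat \<Rightarrow> (nat \<rightharpoonup> nat) \<Rightarrow> bool" where
  "partial_injection m n \<alpha> \<longleftrightarrow> (\<forall>x y. \<alpha> x = Some y \<longrightarrow> 0 < x \<and> x \<le> m \<and> 0 < y \<and> y \<le> n) \<and>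
     (\<forall>x x' y. \<alpha> x = Some y \<longrightarrow> \<alpha> x' = Some y \<longrightarrow> x = x')"

lemma partial_injection_iff: "\<alpha> \<in> partial_injections m n \<longleftrightarrow> partial_injection m n \<alpha>"
proof -
  have inj: "inj_on \<alpha> (dom \<alpha>) \<longleftrightarrow> (\<forall>x x' y. \<alpha> x = Some y \<longrightarrow> \<alpha> x' = Some y \<longrightarrow> x = x')"
    by (force simp: inj_on_def dom_def)
  have dom: "dom \<alpha> \<subseteq> {1..m} \<longleftrightarrow> (\<forall>x y. \<alpha> x = Some y \<longrightarrow> 0 < x \<and> x \<le> m)"
    by (auto simp: dom_def Suc_le_eq)
  have ran: "ran \<alpha> \<subseteq> {1..n} \<longleftrightarrow> (\<forall>x y. \<alpha> x = Some y \<longrightarrow> 0 < y \<and> y \<le> n)"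
    by (auto simp: ran_def Suc_le_eq)
  show ?thesis
    unfolding partial_injections_def partial_injection_def mem_Collect_eq inj dom ran by iprover
qed

lemma partial_injection_outside: "\<lbrakk>partial_injection m n \<alpha>; \<not> (0 < x \<and> x \<le> m)\<rbrakk> \<Longrightarrow> \<alpha> x = None"
  unfolding partial_injection_def by (cases "\<alpha> x") blast+

lemma mem_wreath:
  "(a, m, n, \<alpha>) \<in> mors (wreath_category M) \<longleftrightarrow> partial_injection m n \<alpha> \<and> wreath_tuple M m \<alpha> a"
proof -
  have supp: "tuple_supp a = dom \<alpha> \<longleftrightarrow> (\<forall>i<m. a ! i = None \<longleftrightarrow> \<alpha> (Suc i) = None)"
    if "partial_injection m n \<alpha>" "length a = m"
  proof
    assume supp: "tuple_supp a = dom \<alpha>"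
    show "\<forall>i<m. a ! i = None \<longleftrightarrow> \<alpha> (Suc i) = None"
    proof (intro allI impI)
      fix i assume "i < m"
      then have "Suc i \<in> tuple_supp a \<longleftrightarrow> a ! i \<noteq> None"
        using that by (simp add: tuple_supp_def)
      then show "a ! i = None \<longleftrightarrow> \<alpha> (Suc i) = None" by (auto simp: supp dom_def)
    qed
  next
    assume R: "\<forall>i<m. a ! i = None \<longleftrightarrow> \<alpha> (Suc i) = None"
    show "tuple_supp a = dom \<alpha>"
    proof (rule Set.set_eqI)
      fix x
      show "x \<in> tuple_supp a \<longleftrightarrow> x \<in> dom \<alpha>"
      proof (cases "x \<in> {1..m}")
        case True
        then obtain i where "x = Suc i" "i < m" by (cases x) auto
        then show ?thesis using that R by (auto simp: tuple_supp_def dom_def)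
      next
        case False
        then have "\<alpha> x = None" using partial_injection_outside[OF that(1), of x] by auto
        then show ?thesis using False that(2) by (auto simp: tuple_supp_def dom_def)
      qed
    qed
  qed
  have entries: "set a \<subseteq> insert None (Some ` carrier M)
      \<longleftrightarrow> (\<forall>i<length a. a ! i \<in> insert None (Some ` carrier M))"
    by (simp only: subset_eq all_set_conv_all_nth)
  have "(a, m, n, \<alpha>) \<in> mors (wreath_category M) \<longleftrightarrow> partial_injection m n \<alpha> \<and> length a = m
      \<and> set a \<subseteq> insert None (Some ` carrier M) \<and> tuple_supp a = dom \<alpha>"
    by (simp add: wreath_category_def sym_inv_category_def adjoin_zero_def partial_injection_iff)
  then show ?thesis
    using supp entries unfolding wreath_tuple_def by blast
qed

lemma length_tuple_pull [simp]: "length (tuple_pull (m, n, \<alpha>) b) = m"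
  by (simp add: tuple_pull_def)

lemma nth_tuple_pull [simp]:
  "i < m \<Longrightarrow> tuple_pull (m, n, \<alpha>) b ! i = (case \<alpha> (Suc i) of Some j \<Rightarrow> b ! (j - 1) | None \<Rightarrow> None)"
  by (simp add: tuple_pull_def del: upt_Suc)

lemma wreath_comp_closed:
  assumes "monoid M" and \<alpha>: "partial_injection m n \<alpha>" and a: "wreath_tuple M m \<alpha> a"
    and \<beta>: "partial_injection n k \<beta>" and b: "wreath_tuple M n \<beta> b"
  shows "partial_injection m k (\<beta> \<circ>\<^sub>m \<alpha>)"
    and "wreath_tuple M m (\<beta> \<circ>\<^sub>m \<alpha>) (map2 (mult (adjoin_zero M)) a (tuple_pull (m, n, \<alpha>) b))"
proof -
  show "partial_injection m k (\<beta> \<circ>\<^sub>m \<alpha>)"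
    using \<alpha> \<beta> unfolding partial_injection_def map_comp_def
    by (auto split: option.splits) 
  interpret monoid M by fact
  show "wreath_tuple M m (\<beta> \<circ>\<^sub>m \<alpha>) (map2 (mult (adjoin_zero M)) a (tuple_pull (m, n, \<alpha>) b))"
    unfolding wreath_tuple_def
  proof (intro conjI allI impI)
    show "length (map2 (mult (adjoin_zero M)) a (tuple_pull (m, n, \<alpha>) b)) = m"
      using a by (simp add: wreath_tuple_def)
    fix i assume i: "i < m"
    let ?c = "map2 (mult (adjoin_zero M)) a (tuple_pull (m, n, \<alpha>) b) ! i"
    have c: "?c = a ! i \<otimes>\<^bsub>adjoin_zero M\<^esub> (case \<alpha> (Suc i) of Some j \<Rightarrow> b ! (j - 1) | None \<Rightarrow> None)"
      using i a by (simp add: wreath_tuple_def)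
    show "?c \<in> insert None (Some ` carrier M)" "?c = None \<longleftrightarrow> (\<beta> \<circ>\<^sub>m \<alpha>) (Suc i) = None"
    proof -
      have "?c \<in> insert None (Some ` carrier M) \<and> (?c = None \<longleftrightarrow> (\<beta> \<circ>\<^sub>m \<alpha>) (Suc i) = None)"
      proof (cases "\<alpha> (Suc i)")
        case None
        then show ?thesis using c by simp
      next
        case (Some j)
        with \<alpha> have j: "0 < j" "j - 1 < n" "Suc (j - 1) = j"
          by (fastforce simp: partial_injection_def)+
        from a i Some obtain x where x: "a ! i = Some x" "x \<in> carrier M"
          by (force simp: wreath_tuple_def)
        from b j(2) have "b ! (j - 1) \<in> insert None (Some ` carrier M)"
          "b ! (j - 1) = None \<longleftrightarrow> \<beta> (Suc (j - 1)) = None"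
          unfolding wreath_tuple_def by blast+
        then show ?thesis using c x Some j(3) by auto
      qed
      then show "?c \<in> insert None (Some ` carrier M)" "?c = None \<longleftrightarrow> (\<beta> \<circ>\<^sub>m \<alpha>) (Suc i) = None"
        by blast+
    qed
  qed
qed

text \<open>
  Pulling back along a partial injection distributes over products of tuples. This is the law that
  makes the composition of a wreath product associative.
\<close>

lemma tuple_pull_mult:
  assumes \<alpha>: "partial_injection m n \<alpha>" and b: "length b = n"
  shows "tuple_pull (m, n, \<alpha>) (map2 (mult (adjoin_zero M)) b (tuple_pull (n, k, \<beta>) c))
    = map2 (mult (adjoin_zero M)) (tuple_pull (m, n, \<alpha>) b) (tuple_pull (m, k, \<beta> \<circ>\<^sub>m \<alpha>) c)"
proof (rule nth_equalityI)
  fix i assume "i < length (tuple_pull (m, n, \<alpha>) (map2 (mult (adjoin_zero M)) b (tuple_pull (n, k, \<beta>) c)))"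
  then have i: "i < m" by simp
  show "tuple_pull (m, n, \<alpha>) (map2 (mult (adjoin_zero M)) b (tuple_pull (n, k, \<beta>) c)) ! i
    = map2 (mult (adjoin_zero M)) (tuple_pull (m, n, \<alpha>) b) (tuple_pull (m, k, \<beta> \<circ>\<^sub>m \<alpha>) c) ! i"
  proof (cases "\<alpha> (Suc i)")
    case (Some j)
    with \<alpha> have "j - 1 < n" "Suc (j - 1) = j"
      by (fastforce simp: partial_injection_def)+
    then show ?thesis using i b Some by simp
  qed (use i in simp)
qed simp

lemma adjoin_zero_assoc:
  assumes "monoid M" "{a, b, c} \<subseteq> insert None (Some ` carrier M)"
  shows "(a \<otimes>\<^bsub>adjoin_zero M\<^esub> b) \<otimes>\<^bsub>adjoin_zero M\<^esub> c = a \<otimes>\<^bsub>adjoin_zero M\<^esub> (b \<otimes>\<^bsub>adjoin_zero M\<^esub> c)"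
  using assms monoid.m_assoc[OF assms(1)] by auto

lemma map2_mult_assoc:
  assumes "monoid M" "length a = n" "length b = n" "length c = n"
    "\<And>i. i < n \<Longrightarrow> {a ! i, b ! i, c ! i} \<subseteq> insert None (Some ` carrier M)"
  shows "map2 (mult (adjoin_zero M)) (map2 (mult (adjoin_zero M)) a b) c
    = map2 (mult (adjoin_zero M)) a (map2 (mult (adjoin_zero M)) b c)"
  by (rule nth_equalityI) (use assms in \<open>auto intro!: adjoin_zero_assoc\<close>)

lemma tuple_pull_carrier:
  assumes "partial_injection m n \<alpha>" "wreath_tuple M n \<beta> b" "i < m"
  shows "tuple_pull (m, n, \<alpha>) b ! i \<in> insert None (Some ` carrier M)"
proof (cases "\<alpha> (Suc i)")
  case (Some j)
  with assms(1) have "j - 1 < n" by (fastforce simp: partial_injection_def)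
  with assms(2) have "b ! (j - 1) \<in> insert None (Some ` carrier M)"
    unfolding wreath_tuple_def by blast
  with assms(3) Some show ?thesis by simp
qed (use assms in simp)

lemma wreath_comp_assoc:
  assumes "monoid M" and \<alpha>: "partial_injection m n \<alpha>" and a: "wreath_tuple M m \<alpha> a"
    and \<beta>: "partial_injection n k \<beta>" and b: "wreath_tuple M n \<beta> b" and c: "wreath_tuple M k \<gamma> c"
  shows "map2 (mult (adjoin_zero M)) (map2 (mult (adjoin_zero M)) a (tuple_pull (m, n, \<alpha>) b))
      (tuple_pull (m, k, \<beta> \<circ>\<^sub>m \<alpha>) c)
    = map2 (mult (adjoin_zero M)) a
      (tuple_pull (m, n, \<alpha>) (map2 (mult (adjoin_zero M)) b (tuple_pull (n, k, \<beta>) c)))"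
proof -
  have "length a = m" "length b = n" using a b by (simp_all add: wreath_tuple_def)
  moreover have "{a ! i, tuple_pull (m, n, \<alpha>) b ! i, tuple_pull (m, k, \<beta> \<circ>\<^sub>m \<alpha>) c ! i}
      \<subseteq> insert None (Some ` carrier M)" if "i < m" for i
    using that a tuple_pull_carrier[OF \<alpha> b that]
      tuple_pull_carrier[OF wreath_comp_closed(1)[OF assms(1-5)] c that]
    unfolding wreath_tuple_def by auto
  ultimately show ?thesis
    by (simp add: tuple_pull_mult[OF \<alpha>] map2_mult_assoc[OF \<open>monoid M\<close>, of _ m])
qed

lemma pmap_sum_simps:
  "0 < x \<Longrightarrow> x \<le> m \<Longrightarrow> pmap_sum m n k \<alpha> \<beta> x = \<alpha> x"
  "0 < x \<Longrightarrow> x \<le> k \<Longrightarrow> pmap_sum m n k \<alpha> \<beta> (m + x) = map_option (\<lambda>y. y + n) (\<beta> x)"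
  "x = 0 \<or> m + k < x \<Longrightarrow> pmap_sum m n k \<alpha> \<beta> x = None"
  by (auto simp: pmap_sum_def)

lemma sum_position:
  fixes x m k :: nat
  obtains "x = 0 \<or> m + k < x" | "0 < x" "x \<le> m" | x' where "x = m + x'" "0 < x'" "x' \<le> k"
proof -
  have "x = m + (x - m) \<and> 0 < x - m \<and> x - m \<le> k" if "\<not> (x = 0 \<or> m + k < x)" "\<not> (0 < x \<and> x \<le> m)"
    using that by linarith
  with that show thesis by blast
qed

text \<open>
  The graph of a sum is the disjoint union of the two graphs. In this form the case distinctions of
  the definition disappear, and sums of sums are compared by comparing their graphs.
\<close>

lemma pmap_sum_eq_Some:
  assumes "partial_injection m n \<alpha>" "partial_injection k l \<beta>"
  shows "pmap_sum m n k \<alpha> \<beta> x = Some y \<longleftrightarrow>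
    \<alpha> x = Some y \<or> (\<exists>x' y'. \<beta> x' = Some y' \<and> x = m + x' \<and> y = n + y')"
proof -
  consider "x = 0 \<or> m + k < x" | "0 < x" "x \<le> m" | x' where "x = m + x'" "0 < x'" "x' \<le> k"
    by (rule sum_position)
  then show ?thesis
    using assms unfolding partial_injection_def
    by cases (fastforce simp: pmap_sum_simps)+
qed

lemma pmap_sum_closed:
  assumes "partial_injection m n \<alpha>" "partial_injection k l \<beta>"
  shows "partial_injection (m + k) (n + l) (pmap_sum m n k \<alpha> \<beta>)"
  using assms(1,2) unfolding partial_injection_def[of "m + k"] pmap_sum_eq_Some[OF assms]
  unfolding partial_injection_def by fastforce

lemma map_eqI: "(\<And>x y. f x = Some y \<longleftrightarrow> g x = Some y) \<Longrightarrow> f = g"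
  by (metis (no_types) ext not_None_eq)

lemma pmap_sum_assoc:
  assumes "partial_injection m n \<alpha>" "partial_injection k l \<beta>" "partial_injection p q \<gamma>"
  shows "pmap_sum (m + k) (n + l) p (pmap_sum m n k \<alpha> \<beta>) \<gamma> = pmap_sum m n (k + p) \<alpha> (pmap_sum k l p \<beta> \<gamma>)"
  using assms
  by (intro map_eqI) (auto simp: pmap_sum_eq_Some pmap_sum_eq_Some[OF pmap_sum_closed]
      pmap_sum_eq_Some[OF _ pmap_sum_closed])

lemma pmap_sum_comp:
  assumes "partial_injection m n \<alpha>" "partial_injection m' n' \<gamma>"
  shows "pmap_sum m k m' (\<beta> \<circ>\<^sub>m \<alpha>) (\<delta> \<circ>\<^sub>m \<gamma>) = pmap_sum n k n' \<beta> \<delta> \<circ>\<^sub>m pmap_sum m n m' \<alpha> \<gamma>"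
proof (rule ext)
  fix x
  consider "x = 0 \<or> m + m' < x" | "0 < x" "x \<le> m" | x' where "x = m + x'" "0 < x'" "x' \<le> m'"
    by (rule sum_position)
  then show "pmap_sum m k m' (\<beta> \<circ>\<^sub>m \<alpha>) (\<delta> \<circ>\<^sub>m \<gamma>) x = (pmap_sum n k n' \<beta> \<delta> \<circ>\<^sub>m pmap_sum m n m' \<alpha> \<gamma>) x"
  proof cases
    case 2
    have "0 < y \<and> y \<le> n" if "\<alpha> x = Some y" for y
      using that assms(1) by (simp add: partial_injection_def)
    with 2 show ?thesis by (cases "\<alpha> x") (simp_all add: pmap_sum_simps map_comp_def)
  next
    case 3
    have "0 < y \<and> y \<le> n'" if "\<gamma> x' = Some y" for y
      using that assms(2) by (simp add: partial_injection_def)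
    with 3 show ?thesis
      by (cases "\<gamma> x'") (simp_all add: pmap_sum_simps map_comp_def add.commute[of _ n])
  qed (simp add: pmap_sum_simps map_comp_def)
qed

lemma pmap_sum_ident: "pmap_sum m m n (Some |` {1..m}) (Some |` {1..n}) = Some |` {1..m + n}"
  by (rule ext) (auto simp: pmap_sum_def restrict_map_def)

lemma wreath_tuple_append:
  assumes "wreath_tuple M m \<alpha> a" "wreath_tuple M k \<beta> b"
  shows "wreath_tuple M (m + k) (pmap_sum m n k \<alpha> \<beta>) (a @ b)"
  unfolding wreath_tuple_def
proof (intro conjI allI impI)
  have len: "length a = m" using assms(1) by (simp add: wreath_tuple_def)
  fix i assume i: "i < m + k"
  consider "i < m" | j where "i = m + j" "j < k" 
    using i by (metis add_less_cancel_left le_Suc_ex not_less)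
  then have "(a @ b) ! i \<in> insert None (Some ` carrier M)
    \<and> ((a @ b) ! i = None \<longleftrightarrow> pmap_sum m n k \<alpha> \<beta> (Suc i) = None)"
  proof cases
    case 1
    then have "a ! i \<in> insert None (Some ` carrier M) \<and> (a ! i = None \<longleftrightarrow> \<alpha> (Suc i) = None)"
      using assms(1) unfolding wreath_tuple_def by blast
    with 1 len show ?thesis by (simp add: nth_append pmap_sum_simps del: insert_iff)
  next
    case 2
    then have "b ! j \<in> insert None (Some ` carrier M) \<and> (b ! j = None \<longleftrightarrow> \<beta> (Suc j) = None)"
      using assms(2) unfolding wreath_tuple_def by blast
    with 2 len show ?thesis
      using pmap_sum_simps(2)[of "Suc j" k m n \<alpha> \<beta>] by (simp add: nth_append del: insert_iff)
  qed
  then show "(a @ b) ! i \<in> insert None (Some ` carrier M)"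
    "(a @ b) ! i = None \<longleftrightarrow> pmap_sum m n k \<alpha> \<beta> (Suc i) = None" by blast+
qed (use assms in \<open>simp add: wreath_tuple_def\<close>)

lemma tuple_pull_append:
  assumes "partial_injection m n \<alpha>" "partial_injection k l \<beta>" "length a = n"
  shows "tuple_pull (m + k, n + l, pmap_sum m n k \<alpha> \<beta>) (a @ b)
    = tuple_pull (m, n, \<alpha>) a @ tuple_pull (k, l, \<beta>) b"
proof (rule nth_equalityI)
  fix i assume "i < length (tuple_pull (m + k, n + l, pmap_sum m n k \<alpha> \<beta>) (a @ b))"
  then have i: "i < m + k" by simp
  consider "i < m" | j where "i = m + j" "j < k" 
    using i by (metis add_less_cancel_left le_Suc_ex not_less)
  then show "tuple_pull (m + k, n + l, pmap_sum m n k \<alpha> \<beta>) (a @ b) ! i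
    = (tuple_pull (m, n, \<alpha>) a @ tuple_pull (k, l, \<beta>) b) ! i"
  proof cases
    case 1
    have "j - 1 < n" if "\<alpha> (Suc i) = Some j" for j
      using that assms(1) by (fastforce simp: partial_injection_def)
    with 1 show ?thesis
      using assms(3) by (auto simp: nth_append pmap_sum_simps split: option.split)
  next
    case 2
    have "0 < y" if "\<beta> (Suc j) = Some y" for y
      using that assms(2) by (simp add: partial_injection_def)
    with 2 show ?thesis
      using assms(3) pmap_sum_simps(2)[of "Suc j" k m n \<alpha> \<beta>]
      by (force simp: nth_append split: option.split)
  qed
qed simp

lemma wreath_ident_mem:
  assumes "monoid M"
  shows "partial_injection n n (Some |` {1..n})" "wreath_tuple M n (Some |` {1..n}) (replicate n (Some \<one>\<^bsub>M\<^esub>))"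
  using monoid.one_closed[OF assms]
  by (auto simp: partial_injection_def wreath_tuple_def restrict_map_def split: if_splits)

lemma wreath_ident_comp:
  assumes "monoid M" "partial_injection m n \<alpha>" "wreath_tuple M m \<alpha> a"
  shows "map2 (mult (adjoin_zero M)) (replicate m (Some \<one>\<^bsub>M\<^esub>)) (tuple_pull (m, m, Some |` {1..m}) a) = a"
    and "\<alpha> \<circ>\<^sub>m (Some |` {1..m}) = \<alpha>"
proof -
  show "map2 (mult (adjoin_zero M)) (replicate m (Some \<one>\<^bsub>M\<^esub>)) (tuple_pull (m, m, Some |` {1..m}) a) = a"
    using assms(3) monoid.l_one[OF assms(1)]
    by (intro nth_equalityI) (auto simp: wreath_tuple_def restrict_map_def)
  show "\<alpha> \<circ>\<^sub>m (Some |` {1..m}) = \<alpha>"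
    using partial_injection_outside[OF assms(2)]
    by (intro ext) (auto simp: map_comp_def restrict_map_def Suc_le_eq)
qed

lemma wreath_comp_ident:
  assumes "monoid M" "partial_injection m n \<alpha>" "wreath_tuple M m \<alpha> a"
  shows "map2 (mult (adjoin_zero M)) a (tuple_pull (m, n, \<alpha>) (replicate n (Some \<one>\<^bsub>M\<^esub>))) = a"
    and "(Some |` {1..n}) \<circ>\<^sub>m \<alpha> = \<alpha>"
proof -
  show "map2 (mult (adjoin_zero M)) a (tuple_pull (m, n, \<alpha>) (replicate n (Some \<one>\<^bsub>M\<^esub>))) = a"
  proof (rule nth_equalityI)
    fix i assume "i < length (map2 (mult (adjoin_zero M)) a (tuple_pull (m, n, \<alpha>) (replicate n (Some \<one>\<^bsub>M\<^esub>))))"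
    then have i: "i < m" "length a = m" using assms(3) by (auto simp: wreath_tuple_def)
    have *: "j - 1 < n" if "\<alpha> (Suc i) = Some j" for j
      using that assms(2) by (fastforce simp: partial_injection_def)
    show "map2 (mult (adjoin_zero M)) a (tuple_pull (m, n, \<alpha>) (replicate n (Some \<one>\<^bsub>M\<^esub>))) ! i = a ! i"
      using i * assms(3) monoid.r_one[OF assms(1)]
      by (cases "\<alpha> (Suc i)") (force simp: wreath_tuple_def)+
  qed (use assms in \<open>simp add: wreath_tuple_def\<close>)
  show "(Some |` {1..n}) \<circ>\<^sub>m \<alpha> = \<alpha>"
  proof (rule ext)
    fix x
    show "(Some |` {1..n} \<circ>\<^sub>m \<alpha>) x = \<alpha> x"
      using assms(2) by (cases "\<alpha> x") (auto simp: map_comp_def restrict_map_def partial_injection_def Suc_le_eq)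
  qed
qed

lemma pmap_sum_empty:
  assumes "partial_injection m n \<alpha>"
  shows "pmap_sum 0 0 m Map.empty \<alpha> = \<alpha>" "pmap_sum m n 0 \<alpha> Map.empty = \<alpha>"
proof -
  have "partial_injection 0 0 Map.empty" by (simp add: partial_injection_def)
  with assms show "pmap_sum 0 0 m Map.empty \<alpha> = \<alpha>" "pmap_sum m n 0 \<alpha> Map.empty = \<alpha>"
    by (intro map_eqI; simp add: pmap_sum_eq_Some)+
qed

lemma wreath_cases:
  assumes "f \<in> mors (wreath_category M)"
  obtains a m n \<alpha> where "f = (a, m, n, \<alpha>)" "partial_injection m n \<alpha>" "wreath_tuple M m \<alpha> a"
  using assms by (cases f) (auto simp: mem_wreath)

lemma tensor_category_wreath:
  assumes M: "monoid M"
  shows "tensor_category (wreath_category M)" (is "tensor_category ?W")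
proof
  fix n m
  show "ident ?W n \<in> mors ?W" using wreath_ident_mem[OF M] by (simp add: wreath_simps mem_wreath)
  show "src ?W (ident ?W n) = n" "rng ?W (ident ?W n) = n" by (simp_all add: wreath_simps)
  show "ident ?W m \<oplus>\<^bsub>?W\<^esub> ident ?W n = ident ?W (m + n)"
    using pmap_sum_ident[of m n] by (simp add: wreath_simps replicate_add)
next
  fix a assume "a \<in> mors ?W"
  then show "ident ?W (src ?W a) \<odot>\<^bsub>?W\<^esub> a = a" "a \<odot>\<^bsub>?W\<^esub> ident ?W (rng ?W a) = a"
    "ident ?W 0 \<oplus>\<^bsub>?W\<^esub> a = a" "a \<oplus>\<^bsub>?W\<^esub> ident ?W 0 = a"
    using wreath_ident_comp[OF M] wreath_comp_ident[OF M]
    by (auto elim!: wreath_cases simp: wreath_simps pmap_sum_empty simp del: One_nat_def)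
next
  fix a b assume "a \<in> mors ?W" "b \<in> mors ?W"
  then show "a \<oplus>\<^bsub>?W\<^esub> b \<in> mors ?W" "src ?W (a \<oplus>\<^bsub>?W\<^esub> b) = src ?W a + src ?W b"
    "rng ?W (a \<oplus>\<^bsub>?W\<^esub> b) = rng ?W a + rng ?W b"
    by (auto elim!: wreath_cases simp: wreath_simps mem_wreath pmap_sum_closed wreath_tuple_append)
next
  fix a b assume "a \<in> mors ?W" "b \<in> mors ?W" "rng ?W a = src ?W b"
  then show "a \<odot>\<^bsub>?W\<^esub> b \<in> mors ?W" "src ?W (a \<odot>\<^bsub>?W\<^esub> b) = src ?W a" "rng ?W (a \<odot>\<^bsub>?W\<^esub> b) = rng ?W b"
    using wreath_comp_closed[OF M] by (auto elim!: wreath_cases simp: wreath_simps mem_wreath)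
next
  fix a b c assume "a \<in> mors ?W" "b \<in> mors ?W" "c \<in> mors ?W"
  then show "a \<oplus>\<^bsub>?W\<^esub> b \<oplus>\<^bsub>?W\<^esub> c = a \<oplus>\<^bsub>?W\<^esub> (b \<oplus>\<^bsub>?W\<^esub> c)"
    by (auto elim!: wreath_cases simp: wreath_simps pmap_sum_assoc)
  assume "rng ?W a = src ?W b" "rng ?W b = src ?W c"
  with \<open>a \<in> mors ?W\<close> \<open>b \<in> mors ?W\<close> \<open>c \<in> mors ?W\<close>
  show "a \<odot>\<^bsub>?W\<^esub> b \<odot>\<^bsub>?W\<^esub> c = a \<odot>\<^bsub>?W\<^esub> (b \<odot>\<^bsub>?W\<^esub> c)"
    by (auto elim!: wreath_cases simp: wreath_simps wreath_comp_assoc[OF M])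
      (auto simp: map_comp_def split: option.splits intro!: ext)
next
  fix a b c d assume "a \<in> mors ?W" "b \<in> mors ?W" "c \<in> mors ?W" "d \<in> mors ?W"
    "rng ?W a = src ?W b" "rng ?W c = src ?W d"
  then show "a \<odot>\<^bsub>?W\<^esub> b \<oplus>\<^bsub>?W\<^esub> (c \<odot>\<^bsub>?W\<^esub> d) = (a \<oplus>\<^bsub>?W\<^esub> c) \<odot>\<^bsub>?W\<^esub> (b \<oplus>\<^bsub>?W\<^esub> d)"
    by (auto elim!: wreath_cases simp: wreath_simps pmap_sum_comp tuple_pull_append wreath_tuple_def)
qed


section \<open>Codes in the wreath product\<close>

definition wreath_gen :: "('m, 's) monoid_scheme \<Rightarrow> ('x list \<Rightarrow> 'm) \<Rightarrow> 'x edge \<Rightarrow> 'm wmor" where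
  "wreath_gen M \<phi> e = (case e of
     EdgeX \<Rightarrow> ([Some \<one>\<^bsub>M\<^esub>, Some \<one>\<^bsub>M\<^esub>], 2, 2, [1 \<mapsto> 2, 2 \<mapsto> 1])
   | EdgeU \<Rightarrow> ([None], 1, 0, Map.empty)
   | EdgeV \<Rightarrow> ([], 0, 1, Map.empty)
   | Letter x \<Rightarrow> ([Some (\<phi> [x])], 1, 1, [1 \<mapsto> 1]))"

text \<open>
  What the computation of codes in the wreath product uses of a presentation: an evaluation of words
  that is multiplicative and onto.
\<close>

locale monoid_with_words = monoid M
  for M :: "('m, 's) monoid_scheme" (structure) and X :: "'x set" and \<phi> :: "'x list \<Rightarrow> 'm" +
  assumes word_closed [simp]: "w \<in> lists X \<Longrightarrow> \<phi> w \<in> carrier M"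
    and word_Nil [simp]: "\<phi> [] = \<one>"
    and word_append: "\<lbrakk>u \<in> lists X; v \<in> lists X\<rbrakk> \<Longrightarrow> \<phi> (u @ v) = \<phi> u \<otimes> \<phi> v"
    and word_surj: "a \<in> carrier M \<Longrightarrow> \<exists>w\<in>lists X. \<phi> w = a"
begin

abbreviation W where "W \<equiv> wreath_category M"
abbreviation evW where "evW \<equiv> interp W (wreath_gen M \<phi>)"

lemma less_2_3: "(i::nat) < 2 \<longleftrightarrow> i = 0 \<or> i = 1" "(i::nat) < 3 \<longleftrightarrow> i = 0 \<or> i = 1 \<or> i = 2"
  by linarith+

lemma edge_assignment_W: "edge_assignment W (wreath_digraph X) (wreath_gen M \<phi>)"
proof -
  interpret W: tensor_category W by (rule tensor_category_wreath) (rule monoid_axioms)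
  show ?thesis
  proof
    fix e assume "e \<in> arcs (wreath_digraph X)"
    then show "wreath_gen M \<phi> e \<in> mors W"
      "src W (wreath_gen M \<phi> e) = tail (wreath_digraph X) e"
      "rng W (wreath_gen M \<phi> e) = head (wreath_digraph X) e"
      by (auto simp: wreath_gen_def wreath_simps mem_wreath partial_injection_def wreath_tuple_def
        less_2_3 split: if_splits)
  qed
qed

sublocale W: edge_assignment W "wreath_digraph X" "wreath_gen M \<phi>"
  by (rule edge_assignment_W)

lemma upt_3: "[Suc 0..<3] = [1, 2]" "[Suc 0..<4] = [1, 2, 3]"
  by (simp_all add: upt_rec)

text \<open>
  Each relation is an equation between explicit tuples and partial maps on at most three points.
\<close>

lemma wreath_model_W: "wreath_model W X (wreath_gen M \<phi>)"
proof
  fix s t assume "(s, t) \<in> structural_relations X"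
  then show "evW s = evW t"
    by cases (auto simp: wreath_gen_def wreath_simps tuple_pull_def upt_3 numeral_2_eq_2 map_comp_def
          restrict_map_def pmap_sum_def fun_eq_iff)
qed


lemma interp_word: "w \<in> lists X \<Longrightarrow> evW (word_term w) = ([Some (\<phi> w)], 1, 1, [1 \<mapsto> 1])"
proof (induction w)
  case Nil
  then show ?case by (auto simp: wreath_simps restrict_map_def fun_eq_iff)
next
  case (Cons x w)
  then have "\<phi> (x # w) = \<phi> [x] \<otimes> \<phi> w" using word_append[of "[x]" w] by simp
  moreover have "wreath_gen M \<phi> (Letter x) = ([Some (\<phi> [x])], 1, 1, [1 \<mapsto> 1])"
    by (simp add: wreath_gen_def)
  ultimately show ?case
    using Cons by (simp add: wreath_simps tuple_pull_def map_comp_def fun_eq_iff)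
qed

lemma interp_births: "evW (births_term n) = ([], 0, n, Map.empty)"
proof (induction n)
  case 0
  then show ?case by (auto simp: wreath_simps restrict_map_def fun_eq_iff)
next
  case (Suc n)
  then show ?case
    by (auto simp: wreath_gen_def wreath_simps pmap_sum_def fun_eq_iff)
qed

definition cycle_map :: "nat \<Rightarrow> (nat \<rightharpoonup> nat)" where
  "cycle_map p x = (if x = 1 then Some (Suc p) else if 2 \<le> x \<and> x \<le> Suc p then Some (x - 1) else None)"

lemma interp_cycle: "evW (cycle_term p) = (replicate (Suc p) (Some \<one>), Suc p, Suc p, cycle_map p)"
proof (induction p)
  case 0
  then show ?case by (auto simp: wreath_simps restrict_map_def cycle_map_def fun_eq_iff)
next
  case (Suc p)
  let ?a = "replicate (Suc (Suc p)) (Some \<one>)"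
  let ?\<alpha> = "pmap_sum (Suc p) (Suc p) 1 (cycle_map p) (Some |` {1..1})"
  let ?\<beta> = "pmap_sum p p 2 (Some |` {1..p}) [1 \<mapsto> 2, 2 \<mapsto> 1]"
  have l: "evW (Tens (cycle_term p) (Ident 1)) = (?a, Suc (Suc p), Suc (Suc p), ?\<alpha>)"
    using Suc by (simp add: wreath_simps replicate_append_same)
  have "replicate p c @ [c, c] = c # c # replicate p c" for c :: "'m option"
    by (induction p) simp_all
  then have r: "evW (Tens (Ident p) (Edge EdgeX)) = (?a, Suc (Suc p), Suc (Suc p), ?\<beta>)"
    by (simp add: wreath_simps wreath_gen_def)
  have "evW (Tens (cycle_term p) (Ident 1)) \<in> mors W" by simp
  then have "partial_injection (Suc (Suc p)) (Suc (Suc p)) ?\<alpha>" "wreath_tuple M (Suc (Suc p)) ?\<alpha> ?a"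
    unfolding l mem_wreath by simp_all
  note tuple = wreath_comp_ident(1)[OF monoid_axioms this]
  have "?\<beta> \<circ>\<^sub>m ?\<alpha> = cycle_map (Suc p)"
    by (auto simp: fun_eq_iff pmap_sum_def cycle_map_def restrict_map_def map_comp_def)
  then have "evW (Tens (cycle_term p) (Ident 1)) \<odot>\<^bsub>W\<^esub> evW (Tens (Ident p) (Edge EdgeX))
      = (?a, Suc (Suc p), Suc (Suc p), cycle_map (Suc p))"
    unfolding l r wreath_simps tuple by simp
  then show ?case by simp
qed

text \<open>
  The increasing bijection from the positions other than \<open>p + 1\<close>, renumbered without a gap, to
  their actual places.
\<close>

definition shift_over :: "nat \<Rightarrow> nat \<Rightarrow> nat" where
  "shift_over p y = (if y \<le> p then y else Suc y)"

lemma inj_shift_over: "inj (shift_over p)"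
  by (rule injI) (auto simp: shift_over_def split: if_splits)

lemma interp_code_None:
  assumes "evW (code_term n c) = (a, m, n, \<alpha>)" "valid_code X n c"
  shows "evW (code_term n (None # c)) = (None # a, Suc m, n, \<lambda>x. if x = 0 then None else \<alpha> (x - 1))"
proof -
  have "evW (code_term n c) \<in> mors W" using assms(2) by simp
  then have "partial_injection m n \<alpha>" unfolding assms(1) mem_wreath by simp
  note outside = partial_injection_outside[OF this]
  have "pmap_sum 1 0 m Map.empty \<alpha> = (\<lambda>x. if x = 0 then None else \<alpha> (x - 1))"
    using outside by (auto simp: fun_eq_iff pmap_sum_def option.map_ident)
  then show ?thesis using assms(1) by (simp add: wreath_simps wreath_gen_def)
qed

lemma interp_code_Some:
  assumes "evW (code_term k c) = (a, m, k, \<alpha>)" "valid_code X k c" "w \<in> lists X" "p \<le> k"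
  shows "evW (code_term (Suc k) (Some (w, p) # c)) = (Some (\<phi> w) # a, Suc m, Suc k,
    \<lambda>x. if x = 0 then None else if x = 1 then Some (Suc p) else map_option (shift_over p) (\<alpha> (x - 1)))"
proof -
  let ?\<beta> = "pmap_sum 1 1 m [1 \<mapsto> 1] \<alpha>" and ?a = "Some (\<phi> w) # a"
  let ?\<gamma> = "pmap_sum (Suc p) (Suc p) (k - p) (cycle_map p) (Some |` {1..k - p})"
  have "evW (code_term k c) \<in> mors W" using assms(2) by simp
  then have \<alpha>: "partial_injection m k \<alpha>" unfolding assms(1) mem_wreath by simp
  have l: "evW (Tens (word_term w) (code_term k c)) = (?a, Suc m, Suc k, ?\<beta>)"
    using assms(1,3) by (simp add: interp_word wreath_simps)
  have "Suc k = Suc p + (k - p)" using assms(4) by simp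
  then have r: "evW (Tens (cycle_term p) (Ident (k - p))) = (replicate (Suc k) (Some \<one>), Suc k, Suc k, ?\<gamma>)"
    by (simp add: interp_cycle wreath_simps replicate_add[symmetric])
  have "evW (Tens (word_term w) (code_term k c)) \<in> mors W"
    using assms(2,3) by simp
  then have "partial_injection (Suc m) (Suc k) ?\<beta>" "wreath_tuple M (Suc m) ?\<beta> ?a"
    unfolding l mem_wreath by simp_all
  note tuple = wreath_comp_ident(1)[OF monoid_axioms this]
  have "(?\<gamma> \<circ>\<^sub>m ?\<beta>) x = (if x = 0 then None else if x = 1 then Some (Suc p)
    else map_option (shift_over p) (\<alpha> (x - 1)))" for x
  proof (cases "\<alpha> (x - 1)")
    case None
    then show ?thesis by (simp add: pmap_sum_def cycle_map_def map_comp_def)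
  next
    case (Some y)
    then have "0 < x - 1" "x - 1 \<le> m" "0 < y" "y \<le> k"
      using \<alpha> unfolding partial_injection_def by blast+
    with Some show ?thesis
      by (auto simp: pmap_sum_def cycle_map_def map_comp_def shift_over_def restrict_map_def)
  qed
  then have "?\<gamma> \<circ>\<^sub>m ?\<beta> = (\<lambda>x. if x = 0 then None else if x = 1 then Some (Suc p)
    else map_option (shift_over p) (\<alpha> (x - 1)))" by (rule ext)
  then have "evW (Tens (word_term w) (code_term k c)) \<odot>\<^bsub>W\<^esub> evW (Tens (cycle_term p) (Ident (k - p)))
     = (?a, Suc m, Suc k, \<lambda>x. if x = 0 then None else if x = 1 then Some (Suc p)
    else map_option (shift_over p) (\<alpha> (x - 1)))"
    unfolding l r wreath_simps tuple by simp
  then show ?thesis by simp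
qed

lemma interp_code_cases:
  assumes "valid_code X n c"
  obtains a \<alpha> where "evW (code_term n c) = (a, length c, n, \<alpha>)"
    "partial_injection (length c) n \<alpha>" "wreath_tuple M (length c) \<alpha> a"
proof -
  obtain a m n' \<alpha> where f: "evW (code_term n c) = (a, m, n', \<alpha>)" by (cases "evW (code_term n c)") 
  have "src W (evW (code_term n c)) = length c" "rng W (evW (code_term n c)) = n"
    "evW (code_term n c) \<in> mors W"
    using assms by simp_all
  with that show thesis unfolding f by (simp add: wreath_simps mem_wreath)
qed

text \<open>
  Every morphism has a code: its first strand is split off, and the endpoint of that strand is removed
  from the codomain of the rest. Injectivity guarantees that no other strand ends there.
\<close>

lemma code_surj:
  assumes "partial_injection m n \<beta>" "wreath_tuple M m \<beta> b"
  shows "\<exists>c. valid_code X n c \<and> evW (code_term n c) = (b, m, n, \<beta>)"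
  using assms
proof (induction b arbitrary: m n \<beta>)
  case Nil
  then have m: "m = 0" by (simp add: wreath_tuple_def)
  then have "\<beta> = Map.empty" using Nil(1) partial_injection_outside[of 0 n \<beta>] by (auto simp: fun_eq_iff)
  then show ?case using m by (intro exI[of _ "[]"]) (simp add: interp_births)
next
  case (Cons h a)
  then obtain m' where m: "m = Suc m'" and len: "length a = m'" by (auto simp: wreath_tuple_def)
  have \<beta>: "0 < x \<and> x \<le> Suc m' \<and> 0 < y \<and> y \<le> n" if "\<beta> x = Some y" for x y
    using Cons.prems(1) that by (auto simp: partial_injection_def m)
  have \<beta>_inj: "x = x'" if "\<beta> x = Some y" "\<beta> x' = Some y" for x x' y
    using Cons.prems(1) that by (auto simp: partial_injection_def)
  have \<beta>0: "\<beta> 0 = None" using \<beta>[of 0] by (cases "\<beta> 0") auto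
  have entries: "(h # a) ! i \<in> insert None (Some ` carrier M)" "(h # a) ! i = None \<longleftrightarrow> \<beta> (Suc i) = None"
    if "i < Suc m'" for i
    using Cons.prems(2) that unfolding wreath_tuple_def m by blast+
  have h: "h \<in> insert None (Some ` carrier M)" "h = None \<longleftrightarrow> \<beta> 1 = None"
    using entries[of 0] by simp_all
  have a: "a ! i \<in> insert None (Some ` carrier M) \<and> (a ! i = None \<longleftrightarrow> \<beta> (Suc (Suc i)) = None)"
    if "i < m'" for i
    using entries[of "Suc i"] that by simp
  show ?case
  proof (cases h)
    case None
    \<comment> \<open>Strands are counted from 1, so dropping the first one must leave \<open>\<alpha>\<close> undefined at 0.\<close>
    define \<alpha> where "\<alpha> x = (if x = 0 then None else \<beta> (Suc x))" for x
    have "partial_injection m' n \<alpha>"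
      using \<beta> \<beta>_inj unfolding partial_injection_def \<alpha>_def by (fastforce split: if_splits)
    moreover have "a ! i = None \<longleftrightarrow> \<alpha> (Suc i) = None" if "i < m'" for i
      using a[OF that] by (simp add: \<alpha>_def)
    then have "wreath_tuple M m' \<alpha> a"
      using a len unfolding wreath_tuple_def by blast
    ultimately obtain c where c: "valid_code X n c" "evW (code_term n c) = (a, m', n, \<alpha>)"
      using Cons.IH by blast
    have "(\<lambda>x. if x = 0 then None else \<alpha> (x - 1)) = \<beta>"
    proof (rule ext)
      fix x
      show "(if x = 0 then None else \<alpha> (x - 1)) = \<beta> x"
        using \<beta>0 h(2) None by (cases x; cases "x - 1") (auto simp: \<alpha>_def)
    qed
    then show ?thesis
      using interp_code_None[OF c(2,1)] c(1) None by (intro exI[of _ "None # c"]) (simp add: m)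
  next
    case (Some z)
    then obtain w where w: "w \<in> lists X" "\<phi> w = z" using h(1) word_surj by auto
    from h(2) Some obtain y where "\<beta> 1 = Some y" by auto
    moreover from this obtain p k where "y = Suc p" and n: "n = Suc k" and p: "p \<le> k"
      using \<beta>[of 1 y] by (cases y; cases n) auto
    ultimately have \<beta>1: "\<beta> 1 = Some (Suc p)" by simp
    \<comment> \<open>The remaining strands, with the endpoint \<open>p + 1\<close> deleted from the codomain.\<close>
    define \<alpha> where "\<alpha> x = (if x = 0 then None else map_option (\<lambda>y. if y \<le> p then y else y - 1) (\<beta> (Suc x)))" for x
    have avoid: "y \<noteq> Suc p" if "\<beta> (Suc x) = Some y" "x \<noteq> 0" for x y
      using \<beta>_inj[of "Suc x" "Suc p" 1] \<beta>1 that by auto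
    have \<alpha>_iff: "\<alpha> x = Some y \<longleftrightarrow> x \<noteq> 0 \<and> \<beta> (Suc x) = Some (shift_over p y)" for x y
    proof (cases "\<beta> (Suc x)")
      case None
      then show ?thesis by (simp add: \<alpha>_def)
    next
      case (Some z)
      show ?thesis
      proof (cases "x = 0")
        case False
        then have "z \<noteq> Suc p" using avoid[OF Some] by simp
        then show ?thesis using False Some by (auto simp: \<alpha>_def shift_over_def)
      qed (simp add: \<alpha>_def)
    qed
    have "0 < x \<and> x \<le> m' \<and> 0 < y \<and> y \<le> k" if "\<alpha> x = Some y" for x y
      using that \<beta>[of "Suc x" "shift_over p y"] p n unfolding \<alpha>_iff
      by (auto simp: shift_over_def split: if_splits)
    moreover have "x = x'" if "\<alpha> x = Some y" "\<alpha> x' = Some y" for x x' y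
      using that \<beta>_inj[of "Suc x" "shift_over p y" "Suc x'"] unfolding \<alpha>_iff by simp
    ultimately have "partial_injection m' k \<alpha>" unfolding partial_injection_def by blast
    moreover have "a ! i = None \<longleftrightarrow> \<alpha> (Suc i) = None" if "i < m'" for i
      using a[OF that] by (simp add: \<alpha>_def)
    then have "wreath_tuple M m' \<alpha> a"
      using a len unfolding wreath_tuple_def by blast
    ultimately obtain c where c: "valid_code X k c" "evW (code_term k c) = (a, m', k, \<alpha>)"
      using Cons.IH by blast
    have "(if x = 0 then None else if x = 1 then Some (Suc p) else map_option (shift_over p) (\<alpha> (x - 1))) = \<beta> x" for x
    proof (cases "x \<le> 1")
      case True
      then show ?thesis using \<beta>0 \<beta>1 by (cases x) auto
    next
      case False
      then obtain x' where x': "x = Suc x'" "x' \<noteq> 0" by (cases x) auto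
      show ?thesis
      proof (cases "\<beta> x")
        case None
        then show ?thesis using x' by (simp add: \<alpha>_def)
      next
        case (Some y)
        then show ?thesis using x' avoid[of x' y] by (auto simp: \<alpha>_def shift_over_def)
      qed
    qed
    then have "(\<lambda>x. if x = 0 then None else if x = 1 then Some (Suc p) else map_option (shift_over p) (\<alpha> (x - 1))) = \<beta>"
      by (rule ext)
    then show ?thesis
      using interp_code_Some[OF c(2,1) w(1) p] c(1) w p Some
      by (intro exI[of _ "Some (w, p) # c"]) (simp add: m n)
  qed
qed

text \<open>
  The value of a code in the wreath product determines which strands die and where the others end,
  and it determines the words up to equality in the monoid. Codes with the same value therefore agree
  under every interpretation of the edges that respects equality of words in the monoid.
\<close>

lemma code_unique:
  assumes words: "\<And>u v. \<lbrakk>u \<in> lists X; v \<in> lists X; \<phi> u = \<phi> v\<rbrakk> \<Longrightarrow> interp C g (word_term u) = interp C g (word_term v)"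
    and "valid_code X n c" "valid_code X n d" "evW (code_term n c) = evW (code_term n d)"
  shows "interp C g (code_term n c) = interp C g (code_term n d)"
  using assms(2-)
proof (induction c arbitrary: n d)
  case Nil
  obtain b \<beta> where "evW (code_term n d) = (b, length d, n, \<beta>)"
    using interp_code_cases[OF Nil(2)] by metis
  with Nil(3) have "d = []" by (simp add: interp_births)
  then show ?case by simp
next
  case (Cons s c)
  note eq = Cons.prems(3)
  obtain b' \<beta>' where "evW (code_term n (s # c)) = (b', length (s # c), n, \<beta>')"
    using interp_code_cases[OF Cons.prems(1)] by metis
  moreover obtain b'' \<beta>'' where "evW (code_term n d) = (b'', length d, n, \<beta>'')"
    using interp_code_cases[OF Cons.prems(2)] by metis
  ultimately obtain t d' where d: "d = t # d'" using eq by (cases d) auto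
  show ?case
  proof (cases s)
    case None
    then have c: "valid_code X n c" using Cons.prems(1) by simp
    obtain a \<alpha> where a: "evW (code_term n c) = (a, length c, n, \<alpha>)" "partial_injection (length c) n \<alpha>"
      using interp_code_cases[OF c] by metis
    note ec = interp_code_None[OF a(1) c]
    show ?thesis
    proof (cases t)
      case t: None
      then have d': "valid_code X n d'" using Cons.prems(2) d by simp
      obtain b \<beta> where b: "evW (code_term n d') = (b, length d', n, \<beta>)" "partial_injection (length d') n \<beta>"
        using interp_code_cases[OF d'] by metis
      have E: "a = b" "length c = length d'"
        "(\<lambda>x. if x = 0 then None else \<alpha> (x - 1)) = (\<lambda>x. if x = 0 then None else \<beta> (x - 1))"
        using eq ec interp_code_None[OF b(1) d'] d None t by simp_all
      have "\<alpha> x = \<beta> x" for x using fun_cong[OF E(3), of "Suc x"] by simp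
      then have "\<alpha> = \<beta>" by (rule ext)
      then have "evW (code_term n c) = evW (code_term n d')" using a(1) b(1) E by simp
      from Cons.IH[OF c d' this] show ?thesis using d None t by simp
    next
      case (Some wp)
      then obtain w p where t: "t = Some (w, p)" by (cases wp) auto
      with Cons.prems(2) d obtain k where n: "n = Suc k" and d': "valid_code X k d'" "w \<in> lists X" "p \<le> k"
        by (cases n) auto
      obtain b \<beta> where b: "evW (code_term k d') = (b, length d', k, \<beta>)"
        using interp_code_cases[OF d'(1)] by metis
      show ?thesis using eq ec interp_code_Some[OF b d'] d None t n by simp
    qed
  next
    case (Some wp)
    then obtain w p where s: "s = Some (w, p)" by (cases wp) auto
    with Cons.prems(1) obtain k where n: "n = Suc k" and c: "valid_code X k c" "w \<in> lists X" "p \<le> k"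
      by (cases n) auto
    obtain a \<alpha> where a: "evW (code_term k c) = (a, length c, k, \<alpha>)" "partial_injection (length c) k \<alpha>"
      using interp_code_cases[OF c(1)] by metis
    note ec = interp_code_Some[OF a(1) c]
    show ?thesis
    proof (cases t)
      case t: None
      then have d': "valid_code X n d'" using Cons.prems(2) d by simp
      obtain b \<beta> where b: "evW (code_term n d') = (b, length d', n, \<beta>)"
        using interp_code_cases[OF d'(1)] by metis
      show ?thesis using eq ec interp_code_None[OF b d'] d s t n by simp
    next
      case (Some wp')
      then obtain w' p' where t: "t = Some (w', p')" by (cases wp') auto
      with Cons.prems(2) d n have d': "valid_code X k d'" "w' \<in> lists X" "p' \<le> k" by auto
      obtain b \<beta> where b: "evW (code_term k d') = (b, length d', k, \<beta>)" "partial_injection (length d') k \<beta>"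
        using interp_code_cases[OF d'(1)] by metis
      have E: "\<phi> w = \<phi> w'" "a = b" "length c = length d'"
        "(\<lambda>x. if x = 0 then None else if x = 1 then Some (Suc p) else map_option (shift_over p) (\<alpha> (x - 1)))
          = (\<lambda>x. if x = 0 then None else if x = 1 then Some (Suc p') else map_option (shift_over p') (\<beta> (x - 1)))"
        using eq ec interp_code_Some[OF b(1) d'] d s t n by simp_all
      have p: "p = p'" using fun_cong[OF E(4), of 1] by simp
      have "\<alpha> x = \<beta> x" for x
      proof (cases "x = 0")
        case True
        then show ?thesis
          using partial_injection_outside[OF a(2), of 0] partial_injection_outside[OF b(2), of 0] by simp
      next
        case False
        then have "map_option (shift_over p) (\<alpha> x) = map_option (shift_over p) (\<beta> x)"
          using fun_cong[OF E(4), of "Suc x"] p by simp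
        then show ?thesis using option.inj_map[OF inj_shift_over] by (rule injD[rotated])
      qed
      then have "\<alpha> = \<beta>" by (rule ext)
      then have "evW (code_term k c) = evW (code_term k d')" using a(1) b(1) E by simp
      from Cons.IH[OF c(1) d'(1) this] show ?thesis
        using d s t n p words[OF c(2) d'(2) E(1)] by simp
    qed
  qed
qed

end


section \<open>The presentation\<close>

lemma tensor_congruence_kernel:
  assumes "tensor_category C" and \<Phi>: "tensor_morphism C D \<Phi>"
  shows "tensor_congruence C {(u, v). u \<in> mors C \<and> v \<in> mors C \<and> \<Phi> u = \<Phi> v}" (is "tensor_congruence C ?r")
proof -
  interpret tensor_category C by fact
  have typing: "src C a = src D (\<Phi> a)" "rng C a = rng D (\<Phi> a)" if "a \<in> mors C" for a
    using \<Phi> that by (simp_all add: tensor_morphism_def)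
  have comp: "\<Phi> (a \<odot>\<^bsub>C\<^esub> b) = \<Phi> a \<odot>\<^bsub>D\<^esub> \<Phi> b" if "a \<in> mors C" "b \<in> mors C" "rng C a = src C b" for a b
    using \<Phi> that by (simp add: tensor_morphism_def)
  have tens: "\<Phi> (a \<oplus>\<^bsub>C\<^esub> b) = \<Phi> a \<oplus>\<^bsub>D\<^esub> \<Phi> b" if "a \<in> mors C" "b \<in> mors C" for a b
    using \<Phi> that by (simp add: tensor_morphism_def)
  have parallel: "src C a = src C b \<and> rng C a = rng C b" if "(a, b) \<in> ?r" for a b
    using that by (simp add: typing)
  have "equiv (mors C) ?r"
    by (auto intro!: equivI simp: refl_on_def sym_def trans_def)
  moreover have "?r \<subseteq> parallel_pairs C"
    using parallel by (auto simp: parallel_pairs_def)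
  moreover have "\<forall>(a, b)\<in>?r. \<forall>c\<in>mors C.
      (rng C c = src C a \<longrightarrow> (c \<odot>\<^bsub>C\<^esub> a, c \<odot>\<^bsub>C\<^esub> b) \<in> ?r) \<and>
      (rng C a = src C c \<longrightarrow> (a \<odot>\<^bsub>C\<^esub> c, b \<odot>\<^bsub>C\<^esub> c) \<in> ?r) \<and>
      (c \<oplus>\<^bsub>C\<^esub> a, c \<oplus>\<^bsub>C\<^esub> b) \<in> ?r \<and> (a \<oplus>\<^bsub>C\<^esub> c, b \<oplus>\<^bsub>C\<^esub> c) \<in> ?r"
  proof (clarify, intro conjI impI)
    fix a b c assume ab: "a \<in> mors C" "b \<in> mors C" "\<Phi> a = \<Phi> b" and c: "c \<in> mors C"
    then have st: "src C a = src C b" "rng C a = rng C b" using parallel[of a b] by simp_all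
    show "(c \<odot>\<^bsub>C\<^esub> a, c \<odot>\<^bsub>C\<^esub> b) \<in> ?r" if "rng C c = src C a"
      using ab c st that by (simp add: comp)
    show "(a \<odot>\<^bsub>C\<^esub> c, b \<odot>\<^bsub>C\<^esub> c) \<in> ?r" if "rng C a = src C c"
      using ab c st that by (simp add: comp)
    show "(c \<oplus>\<^bsub>C\<^esub> a, c \<oplus>\<^bsub>C\<^esub> b) \<in> ?r" "(a \<oplus>\<^bsub>C\<^esub> c, b \<oplus>\<^bsub>C\<^esub> c) \<in> ?r"
      using ab c by (simp_all add: tens)
  qed
  ultimately show ?thesis unfolding tensor_congruence_def by (intro conjI)
qed

lemma tensor_congruence_Int:
  assumes "tensor_congruence C r" "tensor_congruence C s"
  shows "tensor_congruence C (r \<inter> s)"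
proof -
  have eq: "equiv (mors C) r" "equiv (mors C) s" using assms by (simp_all add: tensor_congruence_def)
  have "equiv (mors C) (r \<inter> s)"
  proof (rule equivI)
    show "r \<inter> s \<subseteq> mors C \<times> mors C" using equivE[OF eq(1)] by blast
    show "refl_on (mors C) (r \<inter> s)" using eq by (auto simp: equiv_def refl_on_def)
    show "sym (r \<inter> s)" using eq by (auto simp: equiv_def intro: sym_Int)
    show "trans (r \<inter> s)" using eq by (auto simp: equiv_def intro: trans_Int)
  qed
  moreover have "r \<inter> s \<subseteq> parallel_pairs C" using assms(1) by (auto simp: tensor_congruence_def)
  moreover have "\<forall>(a, b)\<in>r \<inter> s. \<forall>c\<in>mors C.
      (rng C c = src C a \<longrightarrow> (c \<odot>\<^bsub>C\<^esub> a, c \<odot>\<^bsub>C\<^esub> b) \<in> r \<inter> s) \<and>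
      (rng C a = src C c \<longrightarrow> (a \<odot>\<^bsub>C\<^esub> c, b \<odot>\<^bsub>C\<^esub> c) \<in> r \<inter> s) \<and>
      (c \<oplus>\<^bsub>C\<^esub> a, c \<oplus>\<^bsub>C\<^esub> b) \<in> r \<inter> s \<and> (a \<oplus>\<^bsub>C\<^esub> c, b \<oplus>\<^bsub>C\<^esub> c) \<in> r \<inter> s"
    using assms unfolding tensor_congruence_def by (clarsimp, blast)
  ultimately show ?thesis unfolding tensor_congruence_def by (intro conjI)
qed

definition wreath_term_relations :: "'x set \<Rightarrow> ('x list \<times> 'x list) set \<Rightarrow> ('x edge trm \<times> 'x edge trm) set" where
  "wreath_term_relations X R = map_prod word_term word_term ` R \<union> structural_relations X"

abbreviation "cls X \<equiv> trm_class (wreath_digraph X)"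

lemma word_mor_class: "w \<in> lists X \<Longrightarrow> word_mor X w = cls X (word_term w)"
  unfolding word_mor_def by (induction w) (auto simp: free_ident gen_def)

text \<open>
  The relations are classes of terms; it is easier to check equations under an interpretation for the
  terms themselves.
\<close>

lemma wreath_relations_classes:
  assumes "R \<subseteq> lists X \<times> lists X"
  shows "wreath_relations X R = map_prod (cls X) (cls X) ` wreath_term_relations X R" (is "_ = ?rhs")
proof
  have struct: "(cls X s, cls X t) \<in> ?rhs" if "(s, t) \<in> structural_relations X" for s t
    using that by (force simp: wreath_term_relations_def)
  note intros = structural_relations.intros[where X = X, THEN struct]
  have words: "(word_mor X u, word_mor X v) \<in> ?rhs" if "(u, v) \<in> R" for u v
  proof -
    have "(word_term u, word_term v) \<in> wreath_term_relations X R"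
      using imageI[OF that, of "map_prod word_term word_term"] by (simp add: wreath_term_relations_def)
    moreover have "u \<in> lists X" "v \<in> lists X" using assms that by auto
    ultimately show ?thesis
      using imageI[of _ "wreath_term_relations X R" "map_prod (cls X) (cls X)"]
      by (simp add: word_mor_class flip: map_prod_simp)
  qed
  show "wreath_relations X R \<subseteq> ?rhs"
    using words intros by (auto simp: wreath_relations_def Let_def gen_def free_ident)
  have "(cls X s, cls X t) \<in> wreath_relations X R" if "(s, t) \<in> structural_relations X" for s t
    using that
  proof cases
    case (6 x)
    then show ?thesis
      unfolding wreath_relations_def Let_def by (intro UnI2 UN_I[of x]) (simp_all add: gen_def free_ident)
  next
    case (7 x)
    then show ?thesis
      unfolding wreath_relations_def Let_def by (intro UnI2 UN_I[of x]) (simp_all add: gen_def free_ident)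
  next
    case (8 x)
    then show ?thesis
      unfolding wreath_relations_def Let_def by (intro UnI2 UN_I[of x]) (simp_all add: gen_def free_ident)
  qed (simp_all add: wreath_relations_def Let_def gen_def free_ident)
  moreover have "(cls X (word_term u), cls X (word_term v)) \<in> wreath_relations X R" if "(u, v) \<in> R" for u v
  proof -
    have "u \<in> lists X" "v \<in> lists X" using assms that by auto
    then have "(cls X (word_term u), cls X (word_term v)) = (word_mor X u, word_mor X v)"
      by (simp add: word_mor_class)
    with that show ?thesis unfolding wreath_relations_def Let_def by blast
  qed
  ultimately show "?rhs \<subseteq> wreath_relations X R"
    by (auto simp: wreath_term_relations_def)
qed

lemma wreath_term_relations_typing:
  assumes "R \<subseteq> lists X \<times> lists X" "(s, t) \<in> wreath_term_relations X R"
  shows "wf_trm (wreath_digraph X) s" "wf_trm (wreath_digraph X) t"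
    "trm_src (wreath_digraph X) s = trm_src (wreath_digraph X) t"
    "trm_rng (wreath_digraph X) s = trm_rng (wreath_digraph X) t"
proof -
  have "wf_trm (wreath_digraph X) s \<and> wf_trm (wreath_digraph X) t \<and>
    trm_src (wreath_digraph X) s = trm_src (wreath_digraph X) t \<and>
    trm_rng (wreath_digraph X) s = trm_rng (wreath_digraph X) t"
  proof (cases "(s, t) \<in> structural_relations X")
    case True
    then show ?thesis by cases simp_all
  next
    case False
    then obtain u v where "(u, v) \<in> R" "s = word_term u" "t = word_term v"
      using assms(2) by (auto simp: wreath_term_relations_def)
    then show ?thesis using assms(1) by auto
  qed
  then show "wf_trm (wreath_digraph X) s" "wf_trm (wreath_digraph X) t"
    "trm_src (wreath_digraph X) s = trm_src (wreath_digraph X) t"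
    "trm_rng (wreath_digraph X) s = trm_rng (wreath_digraph X) t" by auto
qed

lemma (in wreath_model) interp_word_append:
  "\<lbrakk>u \<in> lists X; v \<in> lists X\<rbrakk> \<Longrightarrow> ev (word_term (u @ v)) = ev (word_term u) \<odot> ev (word_term v)"
  by (induction u) (auto simp: comp_assoc)

text \<open>
  Equality of interpreted words is a congruence on the free monoid, so it contains the generated one.
\<close>

lemma (in wreath_model) word_relations_hold:
  assumes R: "R \<subseteq> lists X \<times> lists X"
    and holds: "\<And>u v. (u, v) \<in> R \<Longrightarrow> ev (word_term u) = ev (word_term v)"
    and uv: "(u, v) \<in> generated_monoid_congruence (free_monoid X) R"
  shows "ev (word_term u) = ev (word_term v)"
proof -
  let ?r = "{(u, v). u \<in> lists X \<and> v \<in> lists X \<and> ev (word_term u) = ev (word_term v)}"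
  have "equiv (lists X) ?r"
    by (auto intro!: equivI simp: refl_on_def sym_def trans_def)
  then have "monoid_congruence (free_monoid X) ?r"
    by (auto simp: monoid_congruence_def free_monoid_def interp_word_append)
  moreover have "R \<subseteq> ?r" using R holds by auto
  ultimately have "(u, v) \<in> ?r" using uv unfolding generated_monoid_congruence_def by blast
  then show ?thesis by simp
qed

locale presented_monoid = monoid M
  for M :: "('m, 's) monoid_scheme" (structure) and X :: "'x set"
    and R :: "('x list \<times> 'x list) set" and \<phi> :: "'x list \<Rightarrow> 'm" +
  assumes presentation: "monoid_presentation M X R \<phi>"
begin

sublocale monoid_with_words M X \<phi>
proof
  have hom: "\<phi> \<in> hom (free_monoid X) M" using presentation by (simp add: monoid_presentation_def)
  show "\<phi> w \<in> carrier M" if "w \<in> lists X" for w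
    using hom that by (auto simp: hom_def free_monoid_def)
  show "\<phi> [] = \<one>" using presentation by (simp add: monoid_presentation_def)
  show "\<phi> (u @ v) = \<phi> u \<otimes> \<phi> v" if "u \<in> lists X" "v \<in> lists X" for u v
    using hom that by (auto simp: hom_def free_monoid_def)
  show "\<exists>w\<in>lists X. \<phi> w = a" if "a \<in> carrier M" for a
  proof -
    have "\<phi> ` lists X = carrier M" using presentation by (simp add: monoid_presentation_def)
    with that have "a \<in> \<phi> ` lists X" by simp
    then show ?thesis by blast
  qed
qed

lemma R_words: "R \<subseteq> lists X \<times> lists X"
  using presentation by (simp add: monoid_presentation_def)

lemma equal_words_iff:
  "(u, v) \<in> generated_monoid_congruence (free_monoid X) R \<longleftrightarrow> u \<in> lists X \<and> v \<in> lists X \<and> \<phi> u = \<phi> v"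
  using presentation unfolding monoid_presentation_def by blast

lemma R_sound: "(u, v) \<in> R \<Longrightarrow> \<phi> u = \<phi> v"
  using equal_words_iff[of u v] by (auto simp: generated_monoid_congruence_def)

lemma wreath_generator_map_iff:
  "wreath_generator_map M X \<phi> \<Phi> \<longleftrightarrow> tensor_morphism (wreath_free X) W \<Phi> \<and>
     (\<forall>e\<in>arcs (wreath_digraph X). \<Phi> (cls X (Edge e)) = wreath_gen M \<phi> e)"
  by (auto simp: wreath_generator_map_def wreath_gen_def gen_def)

lemma wreath_generator_map_interp:
  assumes "wreath_generator_map M X \<phi> \<Phi>" "wf_trm (wreath_digraph X) t"
  shows "\<Phi> (cls X t) = evW t"
proof -
  have "\<Phi> (cls X t) = interp W (\<lambda>e. \<Phi> (cls X (Edge e))) t"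
    using assms by (intro tensor_morphism_interp) (simp_all add: wreath_generator_map_iff)
  also have "\<dots> = evW t"
    using assms by (intro interp_cong) (auto simp: wreath_generator_map_iff)
  finally show ?thesis .
qed

lemma ex1_wreath_generator_map: "\<exists>!\<Phi>. wreath_generator_map M X \<phi> \<Phi>"
proof (rule ex1I)
  show lift: "wreath_generator_map M X \<phi> (free_lift W (wreath_digraph X) (wreath_gen M \<phi>))"
    using W.tensor_morphism_free_lift by (auto simp: wreath_generator_map_iff)
  fix \<Phi> assume "wreath_generator_map M X \<phi> \<Phi>"
  with lift show "\<Phi> = free_lift W (wreath_digraph X) (wreath_gen M \<phi>)"
    unfolding wreath_generator_map_iff by (intro tensor_morphism_eqI) auto
qed

context
  fixes \<Phi> assumes \<Phi>: "wreath_generator_map M X \<phi> \<Phi>"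
begin

abbreviation "kernel_pairs \<equiv> {(u, v). u \<in> mors (wreath_free X) \<and> v \<in> mors (wreath_free X) \<and> \<Phi> u = \<Phi> v}"

lemma kernel_congruence: "tensor_congruence (wreath_free X) kernel_pairs"
  using \<Phi> by (intro tensor_congruence_kernel[OF tensor_category_free]) (auto simp: wreath_generator_map_iff)

lemma relations_in_kernel: "wreath_relations X R \<subseteq> kernel_pairs"
proof -
  interpret W: wreath_model W X "wreath_gen M \<phi>" by (rule wreath_model_W)
  have "evW s = evW t" if st: "(s, t) \<in> wreath_term_relations X R" for s t
  proof (cases "(s, t) \<in> structural_relations X")
    case True
    then show ?thesis by (rule W.relation_holds)
  next
    case False
    then obtain u v where "(u, v) \<in> R" "s = word_term u" "t = word_term v"
      using st by (auto simp: wreath_term_relations_def)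
    moreover from this(1) R_words have "u \<in> lists X" "v \<in> lists X" by blast+
    ultimately show ?thesis using R_sound[of u v] by (simp add: interp_word)
  qed
  then show ?thesis
    using wreath_term_relations_typing[OF R_words]
    by (auto simp: wreath_relations_classes[OF R_words] wreath_generator_map_interp[OF \<Phi>])
qed

text \<open>
  Two terms with the same image in the wreath product are brought into code form in the quotient by
  \<open>r\<close>. Since \<open>r\<close> is contained in the kernel, the codes still have the same image, so they differ by
  relations between words only, and these hold in the quotient.
\<close>

lemma kernel_least:
  assumes r: "tensor_congruence (wreath_free X) r" "wreath_relations X R \<subseteq> r" and sub: "r \<subseteq> kernel_pairs"
  shows "kernel_pairs \<subseteq> r"
proof -
  interpret Q: quotient_by_congruence "wreath_free X" r
    using tensor_category_free r(1) by (simp add: quotient_by_congruence_def quotient_by_congruence_axioms_def)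
  interpret QC: tensor_category Q.Q by (rule Q.tensor_category_quotient)
  define h where "h e = restrict Q.rep (mors (wreath_free X)) (cls X (Edge e))" for e
  have ev: "Q.rep (cls X t) = interp Q.Q h t" if "wf_trm (wreath_digraph X) t" for t
    using tensor_morphism_interp[OF Q.tensor_morphism_rep that] that unfolding h_def by simp
  have rel: "interp Q.Q h s = interp Q.Q h t \<longleftrightarrow> (cls X s, cls X t) \<in> r"
    if "wf_trm (wreath_digraph X) s" "wf_trm (wreath_digraph X) t" for s t
    using that by (simp add: ev[symmetric] Q.rep_eq_iff)
  have holds: "interp Q.Q h s = interp Q.Q h t" if "(s, t) \<in> wreath_term_relations X R" for s t
  proof -
    have "(cls X s, cls X t) \<in> wreath_relations X R"
      using imageI[OF that, of "map_prod (cls X) (cls X)"] by (simp add: wreath_relations_classes[OF R_words])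
    then show ?thesis using rel wreath_term_relations_typing[OF R_words that] r(2) by blast
  qed
  interpret QM: wreath_model Q.Q X h
  proof
    fix e assume e: "e \<in> arcs (wreath_digraph X)"
    then have "wf_trm (wreath_digraph X) (Edge e)" by simp
    then show "h e \<in> mors Q.Q" "src Q.Q (h e) = tail (wreath_digraph X) e"
      "rng Q.Q (h e) = head (wreath_digraph X) e"
      by (simp_all add: Q.quotient_simps h_def)
  next
    show "interp Q.Q h s = interp Q.Q h t" if "(s, t) \<in> structural_relations X" for s t
      using that by (intro holds) (simp add: wreath_term_relations_def)
  qed
  have words: "interp Q.Q h (word_term u) = interp Q.Q h (word_term v)"
    if "u \<in> lists X" "v \<in> lists X" "\<phi> u = \<phi> v" for u v
  proof (rule QM.word_relations_hold[OF R_words])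
    show "(u, v) \<in> generated_monoid_congruence (free_monoid X) R"
      using that by (simp add: equal_words_iff)
    show "interp Q.Q h (word_term u) = interp Q.Q h (word_term v)" if "(u, v) \<in> R" for u v
      using imageI[OF that, of "map_prod word_term word_term"]
      by (intro holds) (simp add: wreath_term_relations_def)
  qed
  have to_W: "evW s = evW t" 
    if "wf_trm (wreath_digraph X) s" "wf_trm (wreath_digraph X) t" "interp Q.Q h s = interp Q.Q h t" for s t
    using that rel sub by (auto simp: wreath_generator_map_interp[OF \<Phi>])
  show ?thesis
  proof (rule subrelI)
    fix A B assume AB: "(A, B) \<in> kernel_pairs"
    then obtain s t where s: "wf_trm (wreath_digraph X) s" "A = cls X s"
      and t: "wf_trm (wreath_digraph X) t" "B = cls X t"
      by (auto simp: mors_free)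
    have eq: "evW s = evW t" using AB s t by (simp add: wreath_generator_map_interp[OF \<Phi>])
    let ?n = "trm_rng (wreath_digraph X) s"
    have n: "trm_rng (wreath_digraph X) t = ?n"
      using arg_cong[OF eq, of "rng W"] s t by simp
    obtain c where c: "valid_code X ?n c" "interp Q.Q h s = interp Q.Q h (code_term ?n c)"
      using QM.interp_eq_code[OF s(1)] by metis
    obtain d where d: "valid_code X ?n d" "interp Q.Q h t = interp Q.Q h (code_term ?n d)"
      using QM.interp_eq_code[OF t(1)] unfolding n by metis
    have codes: "evW (code_term ?n c) = evW (code_term ?n d)"
      using eq to_W[OF s(1) _ c(2)] to_W[OF t(1) _ d(2)] c(1) d(1) by simp
    have "interp Q.Q h (code_term ?n c) = interp Q.Q h (code_term ?n d)"
      by (rule code_unique[OF _ c(1) d(1) codes]) (rule words)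
    then have "interp Q.Q h s = interp Q.Q h t" unfolding c(2) d(2) .
    then show "(A, B) \<in> r" using rel s t by simp
  qed
qed

lemma wreath_presentation: "tensor_presentation W (wreath_digraph X) (wreath_relations X R) \<Phi>"
proof -
  have morphism: "tensor_morphism (wreath_free X) W \<Phi>" using \<Phi> by (simp add: wreath_generator_map_iff)
  have "wf_digraph (wreath_digraph X)" "verts (wreath_digraph X) = UNIV"
    by (simp_all add: wf_digraph_def wreath_digraph_def)
  moreover have "wreath_relations X R \<subseteq> parallel_pairs (wreath_free X)"
    using wreath_term_relations_typing[OF R_words]
    by (auto simp: wreath_relations_classes[OF R_words] parallel_pairs_def)
  moreover have "\<Phi> ` mors (wreath_free X) = mors W"
  proof
    show "\<Phi> ` mors (wreath_free X) \<subseteq> mors W" using morphism by (auto simp: tensor_morphism_def)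
    show "mors W \<subseteq> \<Phi> ` mors (wreath_free X)"
    proof
      fix f assume "f \<in> mors W"
      then obtain a m n \<alpha> where f: "f = (a, m, n, \<alpha>)" "partial_injection m n \<alpha>" "wreath_tuple M m \<alpha> a"
        by (rule wreath_cases)
      then obtain c where c: "valid_code X n c" "evW (code_term n c) = f" using code_surj by blast
      then have "f = \<Phi> (cls X (code_term n c))" by (simp add: wreath_generator_map_interp[OF \<Phi>])
      then show "f \<in> \<Phi> ` mors (wreath_free X)" by (rule image_eqI) (use c(1) in simp)
    qed
  qed
  moreover have "kernel_pairs = generated_tensor_congruence (wreath_free X) (wreath_relations X R)"
  proof
    show "generated_tensor_congruence (wreath_free X) (wreath_relations X R) \<subseteq> kernel_pairs"
      unfolding generated_tensor_congruence_def using kernel_congruence relations_in_kernel by blast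
    \<comment> \<open>Passing from \<open>r\<close> to its intersection with the kernel makes the previous lemma applicable.\<close>
    have "kernel_pairs \<subseteq> r" if "tensor_congruence (wreath_free X) r" "wreath_relations X R \<subseteq> r" for r
    proof -
      have "kernel_pairs \<subseteq> r \<inter> kernel_pairs"
        using that relations_in_kernel by (intro kernel_least tensor_congruence_Int kernel_congruence) auto
      then show ?thesis by blast
    qed
    then show "kernel_pairs \<subseteq> generated_tensor_congruence (wreath_free X) (wreath_relations X R)"
      unfolding generated_tensor_congruence_def by blast
  qed
  ultimately show ?thesis
    using morphism tensor_category_wreath[OF monoid_axioms] by (simp add: tensor_presentation_def)
qed

end

end

theorem theorem4p17:
  fixes M :: "('m, 's) monoid_scheme"
    and X\<^sub>M :: "'x set"
    and R\<^sub>M :: "('x list \<times> 'x list) set"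
    and \<phi>\<^sub>M :: "'x list \<Rightarrow> 'm"
  assumes "monoid M"
    and "monoid_presentation M X\<^sub>M R\<^sub>M \<phi>\<^sub>M"
  shows "(\<exists>!\<Phi>. wreath_generator_map M X\<^sub>M \<phi>\<^sub>M \<Phi>) \<and>
         (\<forall>\<Phi>. wreath_generator_map M X\<^sub>M \<phi>\<^sub>M \<Phi> \<longrightarrow>
            tensor_presentation (wreath_category M) (wreath_digraph X\<^sub>M)
              (wreath_relations X\<^sub>M R\<^sub>M) \<Phi>)"
proof -
  interpret presented_monoid M X\<^sub>M R\<^sub>M \<phi>\<^sub>M
    using assms by (simp add: presented_monoid_def presented_monoid_axioms_def)
  show ?thesis using ex1_wreath_generator_map wreath_presentation by blast
qed

end
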